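(* Let $X$ be a real random variable with $X>0$ almost surely and with continuous cumulative distribution function. For any integers $n$ and $k\in\{1,\ldots,n-1\}$, for any $a>0$ such that $p=\mathbb{P}(X>a)=P(0)>0$, and any $x\in[0,a]$, the Adaptive Multilevel Splitting estimator $\hat{p}^{n,k}(x)$ is an unbiased estimator of the conditional probability $P(x)=\mathbb{P}(X>a\mid X>x)$: $$\mathbb{E}[\hat{p}^{n,k}(x)]=P(x).$$ In particular, when $x=0$, we have $\mathbb{E}[\hat{p}^{n,k}(0)]=p$.
   Context: The Adaptive Multilevel Splitting (AMS) algorithm with $n$ particles, $k$ resampled particles per iteration ($1\le k\le n-1$), starting level $x\in[0,a]$ and target level $a$ is the following random procedure. Initialization: set $Z^0=x$; sample $X_1^0,\ldots,X_n^0$ i.i.d. with law $\mathcal{L}(X\mid X>x)$; let $\sigma^1$ be the a.s. unique permutation of $\{1,\dots,n\}$ with $X^0_{\sigma^1(1)}<\cdots<X^0_{\sigma^1(n)}$, and let $Z^1=X^0_{(k)}=X^0_{\sigma^1(k)}$ be the $k$-th order statistic. Set $j=1$. Iterations: while $Z^j<a$, conditionally on $Z^j$ sample $k$ new independent random variables $\chi^j_1,\ldots,\chi^j_k$ with law $\mathcal{L}(X\mid X>z)|_{z=Z^j}$ (precisely, $\chi^j_\ell=F(\cdot;Z^j)^{-1}(U^j_\ell)$, where $F(\cdot;z)^{-1}$ is the inverse distribution function of $\mathcal{L}(X\mid X>z)$ and the $U^j_\ell$ are i.i.d. uniform on $(0,1)$, independent of all other random variables). Set $X_i^j=\chi^j_{(\sigma^j)^{-1}(i)}$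 if $(\sigma^j)^{-1}(i)\le k$ (i.e. the $k$ lowest particles are resampled) and $X_i^j=X_i^{j-1}$ otherwise. Let $Z^{j+1}=X^j_{(k)}$ be the $k$-th order statistic of $(X^j_1,\ldots,X^j_n)$ and $\sigma^{j+1}$ the a.s. unique permutation sorting this sample increasingly. Increment $j\leftarrow j+1$. End: $J^{n,k}(x)=j-1$ is the number of iterations, so that $Z^{J^{n,k}(x)}<a$ (when $x<a$) and $Z^{J^{n,k}(x)+1}\ge a$. The estimator is $$\hat{p}^{n,k}(x)=C^{n,k}(x)\left(1-\frac{k}{n}\right)^{J^{n,k}(x)},\qquad C^{n,k}(x)=\frac1n\,\mathrm{Card}\{i:\ X_i^{J^{n,k}(x)}\ge a\}.$$ *)

theory Defs
  imports "HOL-Probability.Probability" "HOL-Combinatorics.Permutations"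
begin

text \<open>
  The algorithm is written as a deterministic function of its random inputs: the initial sample
  \<open>x0 i\<close> (\<open>i \<in> {1..n}\<close>) and the uniform variates \<open>u j l\<close> (\<open>j \<ge> 1\<close>, \<open>l \<in> {1..k}\<close>). The parameter
  \<open>\<mu>\<close> is the law of \<open>X\<close>.
\<close>

definition cond_law :: "real measure \<Rightarrow> real \<Rightarrow> real measure" where
  "cond_law \<mu> z = uniform_measure \<mu> {z<..}"

text \<open>The generalized inverse of the distribution function; only \<open>0 < v < 1\<close> is meaningful.\<close>

definition inverse_cdf :: "real measure \<Rightarrow> real \<Rightarrow> real" where
  "inverse_cdf \<nu> v = Inf {y. v \<le> cdf \<nu> y}"

text \<open>
  A sorting permutation always exists. It is unique when the values are distinct; in case of
  ties, an event of probability zero below, one is chosen arbitrarily.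
\<close>

definition sorting_perm :: "nat \<Rightarrow> (nat \<Rightarrow> real) \<Rightarrow> nat \<Rightarrow> nat" where
  "sorting_perm n y = (SOME \<sigma>. \<sigma> permutes {1..n} \<and> mono_on {1..n} (y \<circ> \<sigma>))"

definition order_stat :: "nat \<Rightarrow> nat \<Rightarrow> (nat \<Rightarrow> real) \<Rightarrow> real" where
  "order_stat n k y = y (sorting_perm n y k)"

text \<open>
  \<open>ams_particles \<mu> n k x0 u j i\<close> is \<open>X\<^sub>i\<^sup>j\<close>. The recursion ignores the stopping rule; only the values
  up to the final iteration \<open>ams_iterations\<close> enter the estimator.
\<close>

primrec ams_particles ::
  "real measure \<Rightarrow> nat \<Rightarrow> nat \<Rightarrow> (nat \<Rightarrow> real) \<Rightarrow> (nat \<Rightarrow> nat \<Rightarrow> real) \<Rightarrow> nat \<Rightarrow> nat \<Rightarrow> real" where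
  "ams_particles \<mu> n k x0 u 0 = x0"
| "ams_particles \<mu> n k x0 u (Suc j) =
    (let y = ams_particles \<mu> n k x0 u j;
         z = order_stat n k y;
         r = inv (sorting_perm n y)
     in (\<lambda>i. if r i \<in> {1..k} then inverse_cdf (cond_law \<mu> z) (u (Suc j) (r i)) else y i))"

definition ams_level ::
  "real measure \<Rightarrow> nat \<Rightarrow> nat \<Rightarrow> real \<Rightarrow> (nat \<Rightarrow> real) \<Rightarrow> (nat \<Rightarrow> nat \<Rightarrow> real) \<Rightarrow> nat \<Rightarrow> real" where
  "ams_level \<mu> n k x x0 u j =
    (case j of 0 \<Rightarrow> x | Suc i \<Rightarrow> order_stat n k (ams_particles \<mu> n k x0 u i))"

definition ams_terminates ::
  "real measure \<Rightarrow> nat \<Rightarrow> nat \<Rightarrow> real \<Rightarrow> real \<Rightarrow> (nat \<Rightarrow> real) \<Rightarrow> (nat \<Rightarrow> nat \<Rightarrow> real) \<Rightarrow> bool" where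
  "ams_terminates \<mu> n k a x x0 u \<longleftrightarrow> (\<exists>j. a \<le> ams_level \<mu> n k x x0 u (Suc j))"

definition ams_iterations ::
  "real measure \<Rightarrow> nat \<Rightarrow> nat \<Rightarrow> real \<Rightarrow> real \<Rightarrow> (nat \<Rightarrow> real) \<Rightarrow> (nat \<Rightarrow> nat \<Rightarrow> real) \<Rightarrow> nat" where
  "ams_iterations \<mu> n k a x x0 u = (LEAST j. a \<le> ams_level \<mu> n k x x0 u (Suc j))"

definition ams_final_fraction ::
  "real measure \<Rightarrow> nat \<Rightarrow> nat \<Rightarrow> real \<Rightarrow> real \<Rightarrow> (nat \<Rightarrow> real) \<Rightarrow> (nat \<Rightarrow> nat \<Rightarrow> real) \<Rightarrow> real" where
  "ams_final_fraction \<mu> n k a x x0 u =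
    1 / real n *
      real (card {i \<in> {1..n}. a \<le> ams_particles \<mu> n k x0 u (ams_iterations \<mu> n k a x x0 u) i})"

text \<open>
  The value \<open>0\<close> on non-terminating runs corresponds to infinitely many iterations; such runs have
  probability zero under the assumptions of the theorem.
\<close>

definition ams_estimator ::
  "real measure \<Rightarrow> nat \<Rightarrow> nat \<Rightarrow> real \<Rightarrow> real \<Rightarrow> (nat \<Rightarrow> real) \<Rightarrow> (nat \<Rightarrow> nat \<Rightarrow> real) \<Rightarrow> real" where
  "ams_estimator \<mu> n k a x x0 u =
    (if ams_terminates \<mu> n k a x x0 u
     then ams_final_fraction \<mu> n k a x x0 u * (1 - real k / real n) ^ ams_iterations \<mu> n k a x x0 u
     else 0)"

end

theory Submission
  imports Defs
begin

text \<open>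
  The idea is that, although the particles interact through the levels, they carry no memory:
  given that the algorithm is still running at level \<open>z\<close>, the whole current sample is again an
  i.i.d. sample of the law of \<open>X\<close> conditioned on \<open>X > z\<close>. The reason is the behaviour of the
  \<open>k\<close>-th order statistic \<open>w\<close> of an i.i.d. sample from an atomless law. Given \<open>w\<close> and the set \<open>S\<close> of
  indices of the \<open>k\<close> lowest points, the other \<open>n - k\<close> points are i.i.d. above \<open>w\<close>; replacing
  the points in \<open>S\<close> by fresh ones above \<open>w\<close> therefore gives a full i.i.d. sample above \<open>w\<close>. This
  is \<open>nn_integral_resample\<close>. An induction over the iterations, with the fresh uniforms of each
  iteration independent of the past, gives \<open>nn_integral_cloud_given_level\<close>.

  For unbiasedness, let \<open>b\<^sub>j\<close> be the expectation of \<open>P(Z\<^sup>j)\<close> on the event that iteration \<open>j\<close> is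
  reached (\<open>alive_value\<close>), where \<open>P(z)\<close> is the probability of \<open>X > a\<close> given \<open>X > z\<close>, and let
  \<open>c\<^sub>j\<close> be the expected number of points above \<open>a\<close> on the event that the algorithm stops there
  (\<open>stopped_survivors\<close>). The memoryless property gives \<open>n b\<^sub>j\<close> for the expected number of points
  above \<open>a\<close> when iteration \<open>j\<close> is reached. A resampling step with level below \<open>a\<close> removes no
  such point and adds \<open>k P(Z)\<close> of them on average. Comparing the count just before and just
  after the step yields \<open>n b\<^sub>j = c\<^sub>j + (n - k) b\<close> with \<open>b = b\<^sub>j\<^sub>+\<^sub>1\<close>, which is \<open>alive_value_Suc\<close>.
  Multiplied by \<open>(1 - k/n)\<^sup>j / n\<close> this telescopes to \<open>P(x) = b\<^sub>0\<close>. The remainder after \<open>m\<close> steps is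
  \<open>(1 - k/n)\<^sup>m b\<^sub>m\<close>, which tends to \<open>0\<close> because \<open>b\<^sub>m \<le> 1\<close>. The sum of the \<open>c\<^sub>j (1 - k/n)\<^sup>j / n\<close> is the
  expectation of the estimator, whose value on runs that never stop is \<open>0\<close>.

  Expectations are handled as nonnegative integrals. The algorithm is a concrete function of its inputs, hence its measurability has to be
  established too; the two delicate ingredients are the sorting permutation, which depends on
  the sample only through finitely many comparisons, and the quantile function as a function
  of both its argument and the level.
\<close>

section \<open>Conditional laws and their quantile functions\<close>

abbreviation unif :: "real measure" where
  "unif \<equiv> uniform_measure lborel {0<..<1}"

abbreviation quantile_above :: "real measure \<Rightarrow> real \<Rightarrow> real \<Rightarrow> real" where
  "quantile_above \<mu> z \<equiv> inverse_cdf (cond_law \<mu> z)"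

lemma prob_space_unif: "prob_space unif"
  by (rule prob_space_uniform_measure) auto

lemma sets_cond_law [simp, measurable_cong]: "sets (cond_law \<mu> z) = sets \<mu>"
  by (simp add: cond_law_def)

lemma real_distribution_cond_law:
  assumes "real_distribution \<mu>" "emeasure \<mu> {z<..} \<noteq> 0"
  shows "real_distribution (cond_law \<mu> z)"
proof -
  interpret real_distribution \<mu> by fact
  have "prob_space (cond_law \<mu> z)"
    unfolding cond_law_def by (rule prob_space_uniform_measure) (use assms in auto)
  then show ?thesis
    by (auto simp: real_distribution_def real_distribution_axioms_def cond_law_def)
qed

text \<open>
  For a level above which \<open>\<mu>\<close> has no mass the conditional law is the zero measure. It is still
  finite, so statements about its distribution function need no case distinction on the level.
\<close>

lemma finite_borel_measure_cond_law:
  assumes "real_distribution \<mu>"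
  shows "finite_borel_measure (cond_law \<mu> z)"
proof (cases "emeasure \<mu> {z<..} = 0")
  case True
  interpret real_distribution \<mu> by fact
  have "emeasure (cond_law \<mu> z) UNIV = 0"
    using True by (simp add: cond_law_def)
  then have "finite_measure (cond_law \<mu> z)"
    by (intro finite_measureI) (simp add: cond_law_def)
  then show ?thesis
    by (simp add: finite_borel_measure_def finite_borel_measure_axioms_def)
next
  case False
  then interpret c: real_distribution "cond_law \<mu> z"
    using real_distribution_cond_law assms by blast
  show ?thesis by (rule c.finite_borel_measure_M)
qed

text \<open>
  Besides computing the distribution function, this shows that it is jointly measurable in the
  level and the argument.
\<close>

lemma cdf_cond_law:
  assumes "real_distribution \<mu>"
  shows "cdf (cond_law \<mu> z) t = max 0 (cdf \<mu> t - cdf \<mu> z) / (1 - cdf \<mu> z)"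
proof -
  interpret real_distribution \<mu> by fact
  have gt: "measure \<mu> {z<..} = 1 - cdf \<mu> z"
  proof -
    have "{z<..} = space \<mu> - {..z}" by auto
    then show ?thesis by (simp only: prob_compl cdf_def2 sets_M[OF borel_closed] closed_atMost)
  qed
  have Int: "measure \<mu> ({z<..} \<inter> {..t}) = max 0 (cdf \<mu> t - cdf \<mu> z)"
  proof (cases "z < t")
    case True
    have "{z<..} \<inter> {..t} = {z<..t}" by auto
    then show ?thesis
      using True cdf_diff_eq[of z t] measure_nonneg[of \<mu> "{z<..t}"] by simp
  next
    case False
    then have "{z<..} \<inter> {..t} = {}" by auto
    then show ?thesis using False cdf_nondecreasing[of t z] by simp
  qed
  show ?thesis
  proof (cases "emeasure \<mu> {z<..} = 0")
    case True
    then have "measure \<mu> {z<..} = 0" by (simp add: measure_def)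
    moreover have "emeasure (cond_law \<mu> z) {..t} = 0"
      using True emeasure_mono[of "{z<..} \<inter> {..t}" "{z<..}" \<mu>] by (simp add: cond_law_def)
    ultimately show ?thesis using gt by (simp add: cdf_def2 measure_def)
  next
    case False
    then show ?thesis
      by (simp add: cdf_def2 cond_law_def Int[unfolded cdf_def2] gt[unfolded cdf_def2])
  qed
qed

text \<open>
  The set \<open>{y. v \<le> cdf \<nu> y}\<close> is everything, empty, or a half line that is closed by right
  continuity. In the first two cases the infimum is an unspecified constant, so they have to be
  separated. Testing them along the integers keeps every condition countable, which is what
  makes the equivalence a proof of measurability for all arguments \<open>v\<close>.
\<close>

lemma inverse_cdf_le_iff:
  assumes "finite_borel_measure \<nu>"
  shows "inverse_cdf \<nu> v \<le> t \<longleftrightarrow>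
    (if \<forall>m. v \<le> cdf \<nu> (- real m) then Inf (UNIV :: real set) \<le> t
     else if \<forall>m. \<not> v \<le> cdf \<nu> (real m) then Inf ({} :: real set) \<le> t
     else v \<le> cdf \<nu> t)"
proof -
  interpret finite_borel_measure \<nu> by fact
  let ?A = "{y. v \<le> cdf \<nu> y}"
  have up: "v \<le> cdf \<nu> y'" if "v \<le> cdf \<nu> y" "y \<le> y'" for y y'
    using that cdf_nondecreasing[of y y'] by linarith
  consider "\<forall>m. v \<le> cdf \<nu> (- real m)" | "\<forall>m. \<not> v \<le> cdf \<nu> (real m)" "\<not> (\<forall>m. v \<le> cdf \<nu> (- real m))"
    | m l where "\<not> v \<le> cdf \<nu> (- real m)" "v \<le> cdf \<nu> (real l)" by blast
  then show ?thesis
  proof cases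
    case 1
    have "v \<le> cdf \<nu> y" for y
    proof -
      obtain m :: nat where "- y \<le> real m" using real_arch_simple by blast
      then show ?thesis using 1 up[of "- real m" y] by auto
    qed
    then have "?A = UNIV" by auto
    with 1 show ?thesis by (simp add: inverse_cdf_def)
  next
    case 2
    have "\<not> v \<le> cdf \<nu> y" for y
    proof -
      obtain m :: nat where "y \<le> real m" using real_arch_simple by blast
      then show ?thesis using 2 up[of y "real m"] by auto
    qed
    then have "?A = {}" by auto
    with 2 show ?thesis by (simp add: inverse_cdf_def)
  next
    case 3
    have ne: "?A \<noteq> {}" using 3 by auto
    have bdd: "bdd_below ?A"
    proof (rule bdd_belowI[of _ "- real m"])
      fix y assume "y \<in> ?A"
      then show "- real m \<le> y" using 3(1) up[of y "- real m"] by (cases "- real m \<le> y") auto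
    qed
    have "v \<le> cdf \<nu> t" if "Inf ?A \<le> t"
    proof -
      have "v \<le> (INF s\<in>?A. cdf \<nu> s)" by (rule cINF_greatest[OF ne]) auto
      also have "\<dots> = cdf \<nu> (Inf ?A)"
        by (rule continuous_at_Inf_mono[symmetric, OF _ cdf_is_right_cont ne bdd])
          (auto intro: monoI cdf_nondecreasing)
      also have "\<dots> \<le> cdf \<nu> t" by (rule cdf_nondecreasing[OF that])
      finally show ?thesis .
    qed
    moreover have "Inf ?A \<le> t" if "v \<le> cdf \<nu> t"
      by (rule cInf_lower) (use that bdd in auto)
    ultimately show ?thesis using 3 by (auto simp: inverse_cdf_def)
  qed
qed

lemma borel_measurable_cdf:
  assumes "real_distribution \<mu>"
  shows "cdf \<mu> \<in> borel_measurable borel"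
proof -
  interpret cdf_distribution \<mu> using assms by (simp add: cdf_distribution_def)
  show ?thesis by simp
qed

lemma measurable_quantile_above:
  assumes \<mu>: "real_distribution \<mu>"
    and [measurable]: "f \<in> borel_measurable \<Omega>" "g \<in> borel_measurable \<Omega>"
  shows "(\<lambda>\<omega>. quantile_above \<mu> (f \<omega>) (g \<omega>)) \<in> borel_measurable \<Omega>"
proof (rule borel_measurableI_le)
  note [measurable] = borel_measurable_cdf[OF \<mu>]
  fix t
  show "{\<omega> \<in> space \<Omega>. quantile_above \<mu> (f \<omega>) (g \<omega>) \<le> t} \<in> sets \<Omega>"
    unfolding inverse_cdf_le_iff[OF finite_borel_measure_cond_law[OF \<mu>]] cdf_cond_law[OF \<mu>]
    by measurable
qed

text \<open>
  Inverse transform sampling. The restriction of Lebesgue measure to the unit interval, for which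
  \<open>cdf_distribution.distr_I_eq_M\<close> is stated, differs from the uniform law only in its space.
\<close>

lemma distr_unif_inverse_cdf:
  assumes "real_distribution \<nu>"
  shows "distr unif borel (inverse_cdf \<nu>) = \<nu>"
proof -
  interpret cdf_distribution \<nu> using assms by (simp add: cdf_distribution_def)
  have res: "distr (restrict_space lborel {0<..<1::real}) borel (inverse_cdf \<nu>) = \<nu>"
    using distr_I_eq_M by (simp add: inverse_cdf_def[abs_def])
  have [measurable]: "inverse_cdf \<nu> \<in> borel_measurable borel"
  proof (rule borel_measurableI_le)
    fix t
    show "{v \<in> space borel. inverse_cdf \<nu> v \<le> t} \<in> sets borel"
      unfolding inverse_cdf_le_iff[OF finite_borel_measure_M] by measurable
  qed
  have "distr unif borel (inverse_cdf \<nu>) = distr (restrict_space lborel {0<..<1::real}) borel (inverse_cdf \<nu>)"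
  proof (rule measure_eqI)
    fix A assume "A \<in> sets (distr unif borel (inverse_cdf \<nu>))"
    then have [measurable]: "A \<in> sets borel" by simp
    have [measurable]: "inverse_cdf \<nu> \<in> borel_measurable (restrict_space lborel {0<..<1})"
      by (rule measurable_restrict_space1) simp
    show "emeasure (distr unif borel (inverse_cdf \<nu>)) A
      = emeasure (distr (restrict_space lborel {0<..<1::real}) borel (inverse_cdf \<nu>)) A"
      by (simp add: emeasure_distr emeasure_restrict_space space_restrict_space divide_ennreal_def
          measurable_sets_borel[OF \<open>inverse_cdf \<nu> \<in> borel_measurable borel\<close>] Int_commute)
  qed simp
  with res show ?thesis by simp
qed

section \<open>Sorting permutations and the block of the lowest particles\<close>

text \<open>
  A stable sort of the list of indices by their values, read as a permutation.
\<close>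

lemma ex_sorting_perm:
  "\<exists>\<sigma>. \<sigma> permutes {1..n} \<and> mono_on {1..n} ((y :: nat \<Rightarrow> real) \<circ> \<sigma>)"
proof -
  define xs where "xs = sort_key y [1..<Suc n]"
  define \<sigma> where "\<sigma> i = (if i \<in> {1..n} then xs ! (i - 1) else i)" for i
  have len: "length xs = n" and dist: "distinct xs" and set: "set xs = {1..n}"
    and sorted: "sorted (map y xs)"
    by (auto simp: xs_def)
  have "bij_betw (\<lambda>i. xs ! (i - 1)) {1..n} {1..n}"
  proof (rule bij_betw_imageI)
    show "inj_on (\<lambda>i. xs ! (i - 1)) {1..n}"
      using dist len by (auto simp: inj_on_def nth_eq_iff_index_eq)
    have "(\<lambda>i. xs ! (i - 1)) ` {1..n} = (\<lambda>i. xs ! (i - 1)) ` Suc ` {..<n}"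
      by (simp only: image_Suc_lessThan)
    also have "\<dots> = (!) xs ` {..<n}"
      by (simp add: image_comp comp_def del: image_Suc_lessThan)
    also have "\<dots> = {1..n}" using set len by (auto simp: set_conv_nth)
    finally show "(\<lambda>i. xs ! (i - 1)) ` {1..n} = {1..n}" .
  qed
  also have "?this \<longleftrightarrow> bij_betw \<sigma> {1..n} {1..n}"
    by (rule bij_betw_cong) (simp add: \<sigma>_def)
  finally have "bij_betw \<sigma> {1..n} {1..n}" .
  then have "\<sigma> permutes {1..n}"
    by (rule bij_imp_permutes) (auto simp: \<sigma>_def)
  moreover have "mono_on {1..n} (y \<circ> \<sigma>)"
  proof (rule mono_onI)
    fix i j assume "i \<in> {1..n}" "j \<in> {1..n}" "i \<le> j"
    then show "(y \<circ> \<sigma>) i \<le> (y \<circ> \<sigma>) j"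
      using sorted_nth_mono[OF sorted, of "i - 1" "j - 1"] len by (simp add: \<sigma>_def)
  qed
  ultimately show ?thesis by blast
qed

lemma sorting_perm_permutes: "sorting_perm n y permutes {1..n}"
  and mono_on_sorting_perm: "mono_on {1..n} (y \<circ> sorting_perm n y)"
  using someI_ex[OF ex_sorting_perm[of n y]] by (auto simp: sorting_perm_def)

text \<open>
  The choice of a sorting permutation sees the sample only through the finite set of its
  pairwise comparisons. This gives both its independence of values outside the index range and
  its measurability, ties included.
\<close>

lemma sorting_perm_eq_comparisons:
  "sorting_perm n y = (SOME \<sigma>. \<sigma> permutes {1..n} \<and>
     (\<forall>i\<in>{1..n}. \<forall>j\<in>{1..n}. i \<le> j \<longrightarrow>
       (\<sigma> i, \<sigma> j) \<in> {p \<in> {1..n} \<times> {1..n}. y (fst p) \<le> y (snd p)}))"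
proof -
  have "mono_on {1..n} (y \<circ> \<sigma>) \<longleftrightarrow> (\<forall>i\<in>{1..n}. \<forall>j\<in>{1..n}. i \<le> j \<longrightarrow>
       (\<sigma> i, \<sigma> j) \<in> {p \<in> {1..n} \<times> {1..n}. y (fst p) \<le> y (snd p)})"
    if "\<sigma> permutes {1..n}" for \<sigma>
    using permutes_in_image[OF that] by (simp add: monotone_on_def)
  then show ?thesis
    unfolding sorting_perm_def by (intro arg_cong[where f=Eps]) (auto simp: fun_eq_iff)
qed

lemma sorting_perm_cong:
  assumes "\<And>i. i \<in> {1..n} \<Longrightarrow> y i = y' i"
  shows "sorting_perm n y = sorting_perm n y'"
proof -
  have "{p \<in> {1..n} \<times> {1..n}. y (fst p) \<le> y (snd p)} = {p \<in> {1..n} \<times> {1..n}. y' (fst p) \<le> y' (snd p)}"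
    using assms by auto
  then show ?thesis by (simp only: sorting_perm_eq_comparisons)
qed

lemma order_stat_cong:
  assumes "\<And>i. i \<in> {1..n} \<Longrightarrow> y i = y' i" and "k \<in> {1..n}"
  shows "order_stat n k y = order_stat n k y'"
  using sorting_perm_cong[of n y y'] assms permutes_in_image[OF sorting_perm_permutes, of n y k]
  by (simp add: order_stat_def)

lemma order_stat_in_range:
  assumes "k \<in> {1..n}"
  shows "\<exists>i\<in>{1..n}. order_stat n k y = y i"
  using assms permutes_in_image[OF sorting_perm_permutes, of n y k]
  by (auto simp: order_stat_def)

text \<open>
  For distinct values, the points up to rank \<open>m\<close> are exactly those not above the point of rank
  \<open>m\<close>.
\<close>

lemma lower_set_sorting_perm:
  assumes inj: "inj_on y {1..n}" and m: "m \<in> {1..n}"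
  shows "{j \<in> {1..n}. y j \<le> y (sorting_perm n y m)} = sorting_perm n y ` {1..m}"
proof -
  let ?\<sigma> = "sorting_perm n y"
  have \<sigma>: "?\<sigma> permutes {1..n}" by (rule sorting_perm_permutes)
  have mono: "y (?\<sigma> l) \<le> y (?\<sigma> l')" if "l \<in> {1..n}" "l' \<in> {1..n}" "l \<le> l'" for l l'
    using mono_on_sorting_perm[of n y] that by (auto simp: monotone_on_def)
  have le_m: "l \<le> m" if l: "l \<in> {1..n}" and le: "y (?\<sigma> l) \<le> y (?\<sigma> m)" for l
  proof (rule ccontr)
    assume "\<not> l \<le> m"
    then have "y (?\<sigma> m) = y (?\<sigma> l)" using mono[of m l] l m le by auto
    then have "?\<sigma> m = ?\<sigma> l"
      using inj l m permutes_in_image[OF \<sigma>] by (auto dest: inj_onD)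
    then show False using permutes_inj[OF \<sigma>] \<open>\<not> l \<le> m\<close> by (auto dest: injD)
  qed
  show ?thesis
  proof (intro equalityI subsetI)
    fix j assume j: "j \<in> {j \<in> {1..n}. y j \<le> y (?\<sigma> m)}"
    then obtain l where "l \<in> {1..n}" "j = ?\<sigma> l"
      using permutes_image[OF \<sigma>] by blast
    with j le_m[of l] show "j \<in> ?\<sigma> ` {1..m}" by auto
  next
    fix j assume "j \<in> ?\<sigma> ` {1..m}"
    then obtain l where l: "l \<in> {1..m}" "j = ?\<sigma> l" by blast
    then have "l \<in> {1..n}" using m by auto
    with l mono[of l m] m permutes_in_image[OF \<sigma>, of l]
    show "j \<in> {j \<in> {1..n}. y j \<le> y (?\<sigma> m)}" by simp
  qed
qed

lemma low_block_unique:
  assumes inj: "inj_on y {1..n}" and i: "i \<in> {1..n}"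
    and k: "card {j \<in> {1..n}. y j \<le> y i} = k"
  shows "sorting_perm n y k = i"
proof -
  let ?\<sigma> = "sorting_perm n y"
  have \<sigma>: "?\<sigma> permutes {1..n}" by (rule sorting_perm_permutes)
  obtain m where m: "m \<in> {1..n}" "i = ?\<sigma> m"
    using i permutes_image[OF \<sigma>] by blast
  have "card (?\<sigma> ` {1..m}) = m"
    using permutes_inj_on[OF \<sigma>] by (subst card_image) auto
  with lower_set_sorting_perm[OF inj m(1)] m k show ?thesis by simp
qed

text \<open>
  The possible outcomes \<open>(S, i)\<close> for the set \<open>S\<close> of the \<open>k\<close> lowest indices and the index \<open>i\<close> of the
  \<open>k\<close>-th order statistic.
\<close>

definition low_blocks :: "nat \<Rightarrow> nat \<Rightarrow> (nat set \<times> nat) set" where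
  "low_blocks n k = {(S, i). S \<subseteq> {1..n} \<and> card S = k \<and> i \<in> S}"

text \<open>
  The inequalities are arranged so that, for \<open>y\<close> split into its values on \<open>S\<close> and on the
  complement, the event is a condition on the former times a product of half lines
  \<open>{y i<..}\<close> for the latter.
\<close>

definition is_low_block :: "nat \<Rightarrow> (nat \<Rightarrow> real) \<Rightarrow> nat set \<Rightarrow> nat \<Rightarrow> bool" where
  "is_low_block n y S i \<longleftrightarrow> S = {j \<in> {1..n}. y j \<le> y i}"

lemma finite_low_blocks: "finite (low_blocks n k)"
  by (rule finite_subset[of _ "Pow {1..n} \<times> {1..n}"]) (auto simp: low_blocks_def)

lemma is_low_blockD:
  assumes inj: "inj_on y {1..n}" and S: "(S, i) \<in> low_blocks n k" "is_low_block n y S i"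
  shows "order_stat n k y = y i"
    and "inv (sorting_perm n y) j \<in> {1..k} \<longleftrightarrow> j \<in> S"
    and "sorting_perm n y k = i" and "S = sorting_perm n y ` {1..k}"
proof -
  let ?\<sigma> = "sorting_perm n y"
  have \<sigma>: "?\<sigma> permutes {1..n}" by (rule sorting_perm_permutes)
  have i: "i \<in> {1..n}" using S by (auto simp: low_blocks_def)
  show \<sigma>k: "?\<sigma> k = i"
    using S by (intro low_block_unique[OF inj i]) (auto simp: low_blocks_def is_low_block_def)
  then show "order_stat n k y = y i" by (simp add: order_stat_def)
  have "k \<in> {1..n}" using i \<sigma>k permutes_in_image[OF \<sigma>, of k] by simp
  then show S_eq: "S = ?\<sigma> ` {1..k}"
    using lower_set_sorting_perm[OF inj] S \<sigma>k by (auto simp: is_low_block_def)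
  show "inv ?\<sigma> j \<in> {1..k} \<longleftrightarrow> j \<in> S"
    unfolding S_eq using permutes_inverses[OF \<sigma>] by (metis image_iff)
qed

lemma ex1_low_block:
  assumes inj: "inj_on y {1..n}" and k: "k \<in> {1..n}"
  shows "\<exists>!p. p \<in> low_blocks n k \<and> is_low_block n y (fst p) (snd p)"
proof -
  let ?\<sigma> = "sorting_perm n y"
  have \<sigma>: "?\<sigma> permutes {1..n}" by (rule sorting_perm_permutes)
  have "card (?\<sigma> ` {1..k}) = k"
    using permutes_inj_on[OF \<sigma>] by (subst card_image) auto
  moreover have "?\<sigma> ` {1..k} \<subseteq> {1..n}"
    unfolding lower_set_sorting_perm[OF inj k, symmetric] by auto
  ultimately have "(?\<sigma> ` {1..k}, ?\<sigma> k) \<in> low_blocks n k"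
    using k by (auto simp: low_blocks_def)
  moreover have "is_low_block n y (?\<sigma> ` {1..k}) (?\<sigma> k)"
    unfolding is_low_block_def lower_set_sorting_perm[OF inj k] ..
  moreover have "p = (?\<sigma> ` {1..k}, ?\<sigma> k)"
    if "p \<in> low_blocks n k \<and> is_low_block n y (fst p) (snd p)" for p
  proof (cases p)
    case (Pair S i)
    then show ?thesis using is_low_blockD(3,4)[OF inj, of S i k] that by simp
  qed
  ultimately show ?thesis by (intro ex1I[of _ "(?\<sigma> ` {1..k}, ?\<sigma> k)"]) (simp only: fst_conv snd_conv)
qed

text \<open>
  A partition of unity: for distinct values exactly one outcome occurs.
\<close>

lemma sum_low_blocks:
  fixes c :: ennreal
  assumes "inj_on y {1..n}" and "k \<in> {1..n}"
  shows "(\<Sum>(S, i)\<in>low_blocks n k. if is_low_block n y S i then c else 0) = c"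
proof -
  obtain p where p: "p \<in> low_blocks n k" "is_low_block n y (fst p) (snd p)"
    and unique: "\<And>p'. p' \<in> low_blocks n k \<Longrightarrow> is_low_block n y (fst p') (snd p') \<Longrightarrow> p' = p"
    using ex1_low_block[OF assms] by blast
  have "(\<Sum>(S, i)\<in>low_blocks n k. if is_low_block n y S i then c else 0)
    = (\<Sum>p'\<in>low_blocks n k. if p' = p then c else 0)"
  proof (rule sum.cong[OF refl])
    fix p' assume "p' \<in> low_blocks n k"
    with p unique[of p'] have "is_low_block n y (fst p') (snd p') \<longleftrightarrow> p' = p" by blast
    then show "(case p' of (S, i) \<Rightarrow> if is_low_block n y S i then c else 0) = (if p' = p then c else 0)"
      by (simp add: case_prod_beta)
  qed
  also have "\<dots> = c" using p(1) by (simp add: finite_low_blocks)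
  finally show ?thesis .
qed

text \<open>
  The set of comparisons takes finitely many values, each on a measurable set.
\<close>

lemma measurable_sorting_perm [measurable]:
  "sorting_perm n \<in> (\<Pi>\<^sub>M i\<in>{1..n}. borel) \<rightarrow>\<^sub>M count_space UNIV"
proof -
  let ?P = "{1..n} \<times> {1..n} :: (nat \<times> nat) set"
  let ?pat = "\<lambda>y :: nat \<Rightarrow> real. {p \<in> ?P. y (fst p) \<le> y (snd p)}"
  have pat: "?pat \<in> (\<Pi>\<^sub>M i\<in>{1..n}. borel) \<rightarrow>\<^sub>M count_space (Pow ?P)"
    unfolding measurable_count_space_eq2[OF finite_Pow_iff[THEN iffD2, OF finite_cartesian_product[OF finite_atLeastAtMost finite_atLeastAtMost]]]
  proof (intro conjI ballI)
    fix Q assume Q: "Q \<in> Pow ?P"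
    define q where "q i j \<longleftrightarrow> (i, j) \<in> Q" for i j
    have "?pat y = Q \<longleftrightarrow> (\<forall>i\<in>{1..n}. \<forall>j\<in>{1..n}. y i \<le> y j \<longleftrightarrow> (i, j) \<in> Q)" for y
    proof
      assume eq: "?pat y = Q"
      show "\<forall>i\<in>{1..n}. \<forall>j\<in>{1..n}. y i \<le> y j \<longleftrightarrow> (i, j) \<in> Q"
        unfolding eq[symmetric] by simp
    next
      assume *: "\<forall>i\<in>{1..n}. \<forall>j\<in>{1..n}. y i \<le> y j \<longleftrightarrow> (i, j) \<in> Q"
      show "?pat y = Q"
      proof (rule set_eqI)
        fix p :: "nat \<times> nat"
        obtain i j where p: "p = (i, j)" by (cases p)
        show "p \<in> ?pat y \<longleftrightarrow> p \<in> Q"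
        proof (cases "i \<in> {1..n} \<and> j \<in> {1..n}")
          case True
          with * p show ?thesis by simp
        next
          case False
          with Q p show ?thesis by auto
        qed
      qed
    qed
    then have "?pat -` {Q} \<inter> space (\<Pi>\<^sub>M i\<in>{1..n}. borel) =
      {y \<in> space (\<Pi>\<^sub>M i\<in>{1..n}. borel). \<forall>i\<in>{1..n}. \<forall>j\<in>{1..n}. y i \<le> y j \<longleftrightarrow> q i j}"
      by (auto simp: q_def)
    also have "\<dots> \<in> sets (\<Pi>\<^sub>M i\<in>{1..n}. borel)"
    proof (intro sets.sets_Collect_finite_All finite_atLeastAtMost)
      fix i j assume ij: "i \<in> {1..n}" "j \<in> {1..n}"
      have comp: "(\<lambda>y :: nat \<Rightarrow> real. y i) \<in> borel_measurable (\<Pi>\<^sub>M i\<in>{1..n}. borel)"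
        "(\<lambda>y :: nat \<Rightarrow> real. y j) \<in> borel_measurable (\<Pi>\<^sub>M i\<in>{1..n}. borel)"
        by (rule measurable_component_singleton[OF ij(1)], rule measurable_component_singleton[OF ij(2)])
      show "{y \<in> space (\<Pi>\<^sub>M i\<in>{1..n}. borel). (y i \<le> (y j :: real)) = q i j} \<in> sets (\<Pi>\<^sub>M i\<in>{1..n}. borel)"
        using borel_measurable_le[OF comp] borel_measurable_less[OF comp(2,1)]
        by (cases "q i j") (simp_all only: simp_thms not_le)
    qed
    finally show "?pat -` {Q} \<inter> space (\<Pi>\<^sub>M i\<in>{1..n}. borel) \<in> sets (\<Pi>\<^sub>M i\<in>{1..n}. borel)" .
  qed auto
  show ?thesis
    unfolding sorting_perm_eq_comparisons[abs_def]
    by (rule measurable_compose[OF pat]) simp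
qed

lemma measurable_order_stat [measurable]:
  assumes k: "k \<in> {1..n}"
  shows "order_stat n k \<in> borel_measurable (\<Pi>\<^sub>M i\<in>{1..n}. borel)"
proof -
  have "(\<lambda>y. if sorting_perm n y k \<in> {1..n} then y (sorting_perm n y k) else 0)
      \<in> borel_measurable (\<Pi>\<^sub>M i\<in>{1..n}. borel)"
  proof (rule measurable_compose_countable[where f="\<lambda>i y. if i \<in> {1..n} then y i else 0"
        and g="\<lambda>y. sorting_perm n y k"])
    show "(\<lambda>y :: nat \<Rightarrow> real. if i \<in> {1..n} then y i else 0) \<in> borel_measurable (\<Pi>\<^sub>M i\<in>{1..n}. borel)" for i
      by (cases "i \<in> {1..n}") auto
    show "(\<lambda>y. sorting_perm n y k) \<in> (\<Pi>\<^sub>M i\<in>{1..n}. borel) \<rightarrow>\<^sub>M count_space UNIV"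
      by (rule measurable_compose[OF measurable_sorting_perm]) simp
  qed
  then show ?thesis
    using permutes_in_image[OF sorting_perm_permutes, of n _ k] k
    by (simp add: order_stat_def[abs_def])
qed

text \<open>
  One iteration as a function of the sample \<open>y\<close> and the new uniforms \<open>v\<close>, restricted to the index
  range so that it takes values in the product space.
\<close>

definition resample ::
  "real measure \<Rightarrow> nat \<Rightarrow> nat \<Rightarrow> (nat \<Rightarrow> real) \<Rightarrow> (nat \<Rightarrow> real) \<Rightarrow> nat \<Rightarrow> real" where
  "resample \<mu> n k y v =
    (\<lambda>i\<in>{1..n}. let r = inv (sorting_perm n y) i in
       if r \<in> {1..k} then quantile_above \<mu> (order_stat n k y) (v r) else y i)"

text \<open>
  The rank of a given index is a natural number valued random variable, so it suffices to treat
  each fixed rank.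
\<close>

lemma measurable_resample:
  assumes \<mu>: "real_distribution \<mu>" and k: "k \<in> {1..n}"
    and f[measurable]: "f \<in> \<Omega> \<rightarrow>\<^sub>M (\<Pi>\<^sub>M i\<in>{1..n}. borel)"
    and g[measurable]: "\<And>l. l \<in> {1..k} \<Longrightarrow> (\<lambda>\<omega>. g \<omega> l) \<in> borel_measurable \<Omega>"
  shows "(\<lambda>\<omega>. resample \<mu> n k (f \<omega>) (g \<omega>)) \<in> \<Omega> \<rightarrow>\<^sub>M (\<Pi>\<^sub>M i\<in>{1..n}. borel)"
  unfolding resample_def Let_def
proof (rule measurable_restrict, rule measurable_compose_countable[where
      f="\<lambda>r \<omega>. if r \<in> {1..k} then quantile_above \<mu> (order_stat n k (f \<omega>)) (g \<omega> r) else f \<omega> i"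
      and g="\<lambda>\<omega>. inv (sorting_perm n (f \<omega>)) i" for i])
  fix i assume i: "i \<in> {1..n}"
  show "(\<lambda>\<omega>. if r \<in> {1..k} then quantile_above \<mu> (order_stat n k (f \<omega>)) (g \<omega> r) else f \<omega> i)
    \<in> borel_measurable \<Omega>" for r
  proof (cases "r \<in> {1..k}")
    case True
    show ?thesis
      unfolding if_P[OF True]
      by (rule measurable_quantile_above[OF \<mu> measurable_compose[OF f measurable_order_stat[OF k]] g[OF True]])
  next
    case False
    show ?thesis
      unfolding if_not_P[OF False]
      by (rule measurable_compose[OF f measurable_component_singleton[OF i]])
  qed
  have "(\<lambda>\<omega>. sorting_perm n (f \<omega>)) \<in> \<Omega> \<rightarrow>\<^sub>M count_space UNIV"
    by measurable
  then show "(\<lambda>\<omega>. inv (sorting_perm n (f \<omega>)) i) \<in> \<Omega> \<rightarrow>\<^sub>M count_space UNIV"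
    by (rule measurable_compose) simp
qed

section \<open>Product laws conditioned to lie above a level\<close>

lemma sets_PiM_unif [measurable_cong]: "sets (PiM S (\<lambda>_. unif)) = sets (\<Pi>\<^sub>M i\<in>S. borel)"
  by (rule sets_PiM_cong) auto

lemma prob_space_PiM_unif: "prob_space (PiM S (\<lambda>_. unif))"
  by (rule prob_space_PiM) (rule prob_space_unif)

definition sample_above :: "real measure \<Rightarrow> nat set \<Rightarrow> real \<Rightarrow> (nat \<Rightarrow> real) \<Rightarrow> nat \<Rightarrow> real" where
  "sample_above \<mu> S z v = (\<lambda>i\<in>S. quantile_above \<mu> z (v i))"

lemma measurable_sample_above:
  assumes \<mu>: "real_distribution \<mu>"
    and f: "f \<in> borel_measurable \<Omega>" and g: "\<And>l. l \<in> S \<Longrightarrow> (\<lambda>\<omega>. g \<omega> l) \<in> borel_measurable \<Omega>"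
  shows "(\<lambda>\<omega>. sample_above \<mu> S (f \<omega>) (g \<omega>)) \<in> \<Omega> \<rightarrow>\<^sub>M (\<Pi>\<^sub>M i\<in>S. borel)"
  unfolding sample_above_def
  by (intro measurable_restrict measurable_quantile_above \<mu> f g)

text \<open>
  An atomless law puts no mass on a coincidence of two coordinates: integrating one of them with
  the others fixed gives the mass of a point.
\<close>

lemma AE_PiM_inj_on:
  assumes "real_distribution \<mu>" and atomless: "\<And>x. emeasure \<mu> {x} = 0" and I: "finite I"
  shows "AE y in PiM I (\<lambda>_. \<mu>). inj_on y I"
proof -
  interpret \<mu>: real_distribution \<mu> by fact
  interpret P: product_sigma_finite "\<lambda>_. \<mu>"
    by (simp add: product_sigma_finite_def \<mu>.sigma_finite_measure_axioms)
  have "AE y in PiM I (\<lambda>_. \<mu>). y i \<noteq> y j" if ij: "i \<in> I" "j \<in> I" "i \<noteq> j" for i j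
  proof -
    let ?D = "{y \<in> space (PiM I (\<lambda>_. \<mu>)). y i = y j}"
    have comp: "(\<lambda>y. y i) \<in> borel_measurable (PiM I (\<lambda>_. \<mu>))" "(\<lambda>y. y j) \<in> borel_measurable (PiM I (\<lambda>_. \<mu>))"
      using measurable_component_singleton[of _ I "\<lambda>_. \<mu>"] ij by (auto simp: measurable_cong_sets[OF refl \<mu>.events_eq_borel])
    have D: "?D \<in> sets (PiM I (\<lambda>_. \<mu>))"
      using borel_measurable_eq[OF comp] by simp
    have I': "I = insert i (I - {i})" using ij by auto
    have "emeasure (PiM I (\<lambda>_. \<mu>)) ?D = (\<integral>\<^sup>+y. indicator ?D y \<partial>PiM I (\<lambda>_. \<mu>))"
      using D by simp
    also have "\<dots> = (\<integral>\<^sup>+y. (\<integral>\<^sup>+x. indicator ?D (y(i := x)) \<partial>\<mu>) \<partial>PiM (I - {i}) (\<lambda>_. \<mu>))"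
      using P.product_nn_integral_insert[of "I - {i}" i "indicator ?D"] I D I' by simp
    also have "\<dots> = (\<integral>\<^sup>+y. 0 \<partial>PiM (I - {i}) (\<lambda>_. \<mu>))"
    proof (rule nn_integral_cong)
      fix y assume "y \<in> space (PiM (I - {i}) (\<lambda>_. \<mu>))"
      have "(\<integral>\<^sup>+x. indicator ?D (y(i := x)) \<partial>\<mu>) \<le> (\<integral>\<^sup>+x. indicator {y j} x \<partial>\<mu>)"
        using ij by (intro nn_integral_mono) (auto split: split_indicator)
      also have "\<dots> = 0" using atomless by simp
      finally show "(\<integral>\<^sup>+x. indicator ?D (y(i := x)) \<partial>\<mu>) = 0" by simp
    qed
    finally have "emeasure (PiM I (\<lambda>_. \<mu>)) ?D = 0" by simp
    then show ?thesis using D by (intro AE_I[of _ _ ?D]) auto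
  qed
  then have "AE y in PiM I (\<lambda>_. \<mu>). \<forall>i\<in>I. \<forall>j\<in>I. i \<noteq> j \<longrightarrow> y i \<noteq> y j"
    using I by (simp add: AE_finite_all)
  then show ?thesis by eventually_elim (auto simp: inj_on_def)
qed

text \<open>
  Conditioning every coordinate on \<open>W\<close> is conditioning the product on the box with sides \<open>W\<close>.
\<close>

lemma PiM_uniform_measure:
  assumes "prob_space \<mu>" and W: "W \<in> sets \<mu>" "emeasure \<mu> W \<noteq> 0" and T: "finite T"
  shows "PiM T (\<lambda>_. uniform_measure \<mu> W) = uniform_measure (PiM T (\<lambda>_. \<mu>)) (\<Pi>\<^sub>E j\<in>T. W)"
proof -
  interpret \<mu>: prob_space \<mu> by fact
  interpret u: prob_space "uniform_measure \<mu> W"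
    by (rule prob_space_uniform_measure) (use W in auto)
  interpret P: product_sigma_finite "\<lambda>_. \<mu>"
    by (simp add: product_sigma_finite_def \<mu>.sigma_finite_measure_axioms)
  interpret U: product_sigma_finite "\<lambda>_. uniform_measure \<mu> W"
    by (simp add: product_sigma_finite_def u.sigma_finite_measure_axioms)
  show ?thesis
  proof (rule U.PiM_eqI[OF T, symmetric])
    show "sets (uniform_measure (PiM T (\<lambda>_. \<mu>)) (\<Pi>\<^sub>E j\<in>T. W)) = sets (PiM T (\<lambda>_. uniform_measure \<mu> W))"
      by (simp, rule sets_PiM_cong) auto
    fix A assume "\<And>i. i \<in> T \<Longrightarrow> A i \<in> sets (uniform_measure \<mu> W)"
    then have A: "\<And>i. i \<in> T \<Longrightarrow> A i \<in> sets \<mu>" by simp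
    have "emeasure (PiM T (\<lambda>_. \<mu>)) ((\<Pi>\<^sub>E j\<in>T. W) \<inter> Pi\<^sub>E T A) = (\<Prod>j\<in>T. emeasure \<mu> (W \<inter> A j))"
      unfolding PiE_Int using A W by (intro P.emeasure_PiM T) auto
    moreover have "emeasure (PiM T (\<lambda>_. \<mu>)) (\<Pi>\<^sub>E j\<in>T. W) = (\<Prod>j\<in>T. emeasure \<mu> W)"
      using W by (intro P.emeasure_PiM T) auto
    ultimately have "emeasure (uniform_measure (PiM T (\<lambda>_. \<mu>)) (\<Pi>\<^sub>E j\<in>T. W)) (Pi\<^sub>E T A)
      = (\<Prod>j\<in>T. emeasure \<mu> (W \<inter> A j)) / (\<Prod>j\<in>T. emeasure \<mu> W)"
      using A W T by (subst emeasure_uniform_measure) (auto intro!: sets_PiM_I_finite)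
    also have "\<dots> = (\<Prod>j\<in>T. emeasure \<mu> (W \<inter> A j) / emeasure \<mu> W)"
    proof -
      have "ennreal (\<Prod>j\<in>T. measure \<mu> (W \<inter> A j)) / ennreal (\<Prod>j\<in>T. measure \<mu> W)
        = ennreal (\<Prod>j\<in>T. measure \<mu> (W \<inter> A j) / measure \<mu> W)"
        using W by (subst divide_ennreal) (auto simp: prod_dividef prod_nonneg \<mu>.emeasure_eq_measure zero_less_measure_iff intro!: prod_nonneg prod_pos)
      also have "\<dots> = (\<Prod>j\<in>T. ennreal (measure \<mu> (W \<inter> A j) / measure \<mu> W))"
        by (subst prod_ennreal) auto
      also have "\<dots> = (\<Prod>j\<in>T. ennreal (measure \<mu> (W \<inter> A j)) / ennreal (measure \<mu> W))"
        using W by (intro prod.cong) (auto simp: divide_ennreal \<mu>.emeasure_eq_measure zero_less_measure_iff)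
      finally show ?thesis by (simp add: \<mu>.emeasure_eq_measure prod_ennreal ennreal_power)
    qed
    also have "\<dots> = (\<Prod>j\<in>T. emeasure (uniform_measure \<mu> W) (A j))"
      using A W by simp
    finally show "emeasure (uniform_measure (PiM T (\<lambda>_. \<mu>)) (\<Pi>\<^sub>E j\<in>T. W)) (Pi\<^sub>E T A)
      = (\<Prod>j\<in>T. emeasure (uniform_measure \<mu> W) (A j))" .
  qed
qed

lemma PiM_cond_law:
  assumes \<mu>: "real_distribution \<mu>" and z: "emeasure \<mu> {z<..} \<noteq> 0" and S: "finite S"
  shows "PiM S (\<lambda>_. cond_law \<mu> z) = distr (PiM S (\<lambda>_. unif)) (\<Pi>\<^sub>M i\<in>S. borel) (sample_above \<mu> S z)"
proof -
  have [measurable]: "quantile_above \<mu> z \<in> borel_measurable borel"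
    by (rule measurable_quantile_above[OF \<mu>]) auto
  \<comment> \<open>The theorem on images of products asks for probability spaces on the target side,
    where only the measurable sets matter; a point mass serves as one.\<close>
  let ?N = "return borel (0 :: real)"
  have "distr (PiM S (\<lambda>_. unif)) (PiM S (\<lambda>_. ?N)) (compose S (quantile_above \<mu> z))
    = PiM S (\<lambda>_. distr unif ?N (quantile_above \<mu> z))"
    by (rule distr_PiM_finite_prob_space'[OF S]) (auto intro: prob_space_unif prob_space_return)
  moreover have "distr unif ?N (quantile_above \<mu> z) = distr unif borel (quantile_above \<mu> z)"
    by (rule distr_cong) auto
  moreover have "distr (PiM S (\<lambda>_. unif)) (PiM S (\<lambda>_. ?N)) (compose S (quantile_above \<mu> z))
    = distr (PiM S (\<lambda>_. unif)) (\<Pi>\<^sub>M i\<in>S. borel) (sample_above \<mu> S z)"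
    by (rule distr_cong) (auto simp: compose_def sample_above_def intro!: sets_PiM_cong)
  ultimately show ?thesis
    by (simp add: distr_unif_inverse_cdf[OF real_distribution_cond_law[OF \<mu> z]])
qed

text \<open>
  An i.i.d. conditional sample, rewritten with independent uniforms. In this form an integral
  against the conditional product law is measurable in the level by Fubini.
\<close>

lemma nn_integral_PiM_cond_law:
  assumes \<mu>: "real_distribution \<mu>" and z: "emeasure \<mu> {z<..} \<noteq> 0" and S: "finite S"
    and g: "g \<in> borel_measurable (\<Pi>\<^sub>M i\<in>S. borel)"
  shows "(\<integral>\<^sup>+y. g y \<partial>PiM S (\<lambda>_. cond_law \<mu> z)) = (\<integral>\<^sup>+v. g (sample_above \<mu> S z v) \<partial>PiM S (\<lambda>_. unif))"
  unfolding PiM_cond_law[OF \<mu> z S]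
proof (rule nn_integral_distr)
  show "sample_above \<mu> S z \<in> PiM S (\<lambda>_. unif) \<rightarrow>\<^sub>M (\<Pi>\<^sub>M i\<in>S. borel)"
    by (intro measurable_sample_above \<mu>) (simp_all add: measurable_cong_sets[OF sets_PiM_unif refl])
qed (simp add: g)

text \<open>
  Points constrained to lie above \<open>w\<close> are, up to the probability of the constraint, i.i.d. from the
  conditional law. For a level with no mass above it both sides are \<open>0\<close>, although the
  integral on the right is then not against a conditional law.
\<close>

lemma nn_integral_PiM_above:
  assumes \<mu>: "real_distribution \<mu>" and T: "finite T" "T \<noteq> {}"
    and g: "g \<in> borel_measurable (\<Pi>\<^sub>M i\<in>T. borel)"
  shows "(\<integral>\<^sup>+y. g y * indicator (\<Pi>\<^sub>E j\<in>T. {w<..}) y \<partial>PiM T (\<lambda>_. \<mu>))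
    = emeasure \<mu> {w<..} ^ card T * (\<integral>\<^sup>+v. g (sample_above \<mu> T w v) \<partial>PiM T (\<lambda>_. unif))"
proof -
  interpret \<mu>: real_distribution \<mu> by fact
  interpret P: product_sigma_finite "\<lambda>_. \<mu>"
    by (simp add: product_sigma_finite_def \<mu>.sigma_finite_measure_axioms)
  let ?W = "\<Pi>\<^sub>E j\<in>T. {w<..}"
  have W: "?W \<in> sets (PiM T (\<lambda>_. \<mu>))" using T by (intro sets_PiM_I_finite) auto
  have eW: "emeasure (PiM T (\<lambda>_. \<mu>)) ?W = emeasure \<mu> {w<..} ^ card T"
    using T by (subst P.emeasure_PiM) auto
  show ?thesis
  proof (cases "emeasure \<mu> {w<..} = 0")
    case True
    then have "?W \<in> null_sets (PiM T (\<lambda>_. \<mu>))"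
      using W eW T by (simp add: null_sets_def card_gt_0_iff)
    then have "(\<integral>\<^sup>+y. g y * indicator ?W y \<partial>PiM T (\<lambda>_. \<mu>)) = 0"
      by (rule nn_integral_null_set)
    then show ?thesis using True T by (simp add: card_gt_0_iff)
  next
    case False
    have g': "g \<in> borel_measurable (PiM T (\<lambda>_. \<mu>))"
      using g by (subst measurable_cong_sets[OF sets_PiM_cong[OF refl] refl, of _ _ "\<lambda>_. borel"]) auto
    have "(\<integral>\<^sup>+v. g (sample_above \<mu> T w v) \<partial>PiM T (\<lambda>_. unif))
      = (\<integral>\<^sup>+y. g y \<partial>PiM T (\<lambda>_. cond_law \<mu> w))"
      using nn_integral_PiM_cond_law[OF \<mu> False T(1) g] by simp
    also have "\<dots> = (\<integral>\<^sup>+y. g y \<partial>uniform_measure (PiM T (\<lambda>_. \<mu>)) ?W)"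
      unfolding cond_law_def
      by (subst PiM_uniform_measure) (use False T \<mu>.prob_space_axioms in auto)
    also have "\<dots> = (\<integral>\<^sup>+y. g y * indicator ?W y \<partial>PiM T (\<lambda>_. \<mu>)) / emeasure \<mu> {w<..} ^ card T"
      by (simp add: nn_integral_uniform_measure[OF g' W] eW)
    finally have eq: "(\<integral>\<^sup>+v. g (sample_above \<mu> T w v) \<partial>PiM T (\<lambda>_. unif))
      = (\<integral>\<^sup>+y. g y * indicator ?W y \<partial>PiM T (\<lambda>_. \<mu>)) / emeasure \<mu> {w<..} ^ card T" .
    have "emeasure \<mu> {w<..} ^ card T \<noteq> 0" "emeasure \<mu> {w<..} ^ card T \<noteq> top"
      using False by (simp_all add: \<mu>.emeasure_eq_measure ennreal_power)
    then show ?thesis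
      unfolding eq ennreal_times_divide
      by (simp add: ennreal_mult_divide_eq mult.commute[of "emeasure \<mu> {w<..} ^ card T"])
  qed
qed

section \<open>Resampling preserves the conditional law given the level\<close>

lemma sets_PiM_law:
  assumes "real_distribution \<mu>"
  shows "sets (PiM S (\<lambda>_. \<mu>)) = sets (\<Pi>\<^sub>M i\<in>S. borel)"
proof -
  interpret real_distribution \<mu> by fact
  show ?thesis by (rule sets_PiM_cong) auto
qed

lemma product_sigma_finite_prob: "prob_space \<mu> \<Longrightarrow> product_sigma_finite (\<lambda>_. \<mu>)"
  by (simp add: product_sigma_finite_def prob_space_imp_sigma_finite)

lemma sets_is_low_block:
  assumes S: "S \<subseteq> {1..n}" and i: "i \<in> {1..n}"
  shows "{y \<in> space (\<Pi>\<^sub>M i\<in>{1..n}. borel). is_low_block n y S i} \<in> sets (\<Pi>\<^sub>M i\<in>{1..n}. borel)"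
proof -
  have "is_low_block n y S i \<longleftrightarrow> (\<forall>j\<in>{1..n}. if j \<in> S then y j \<le> y i else y i < y j)" for y
    using S by (auto simp: is_low_block_def not_le[symmetric])
  moreover have "{y \<in> space (\<Pi>\<^sub>M i\<in>{1..n}. borel). \<forall>j\<in>{1..n}. if j \<in> S then y j \<le> (y i :: real) else y i < y j}
      \<in> sets (\<Pi>\<^sub>M i\<in>{1..n}. borel)"
  proof (intro sets.sets_Collect_finite_All finite_atLeastAtMost)
    fix j assume j: "j \<in> {1..n}"
    have comp: "(\<lambda>y :: nat \<Rightarrow> real. y i) \<in> borel_measurable (\<Pi>\<^sub>M i\<in>{1..n}. borel)"
        "(\<lambda>y :: nat \<Rightarrow> real. y j) \<in> borel_measurable (\<Pi>\<^sub>M i\<in>{1..n}. borel)"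
      by (rule measurable_component_singleton[OF i], rule measurable_component_singleton[OF j])
    show "{y \<in> space (\<Pi>\<^sub>M i\<in>{1..n}. borel). if j \<in> S then y j \<le> (y i :: real) else y i < y j}
      \<in> sets (\<Pi>\<^sub>M i\<in>{1..n}. borel)"
      using borel_measurable_le[OF comp(2,1)] borel_measurable_less[OF comp]
      by (cases "j \<in> S") (simp_all only: if_True if_False)
  qed
  ultimately show ?thesis by simp
qed

text \<open>
  On the event that \<open>S\<close> is the block of the lowest points and \<open>i\<close> its top index, the remaining points
  are only required to lie above \<open>y i\<close>. Integrating them out replaces them by i.i.d. points above
  \<open>y i\<close>. The hypothesis \<open>k < n\<close> guarantees that there are remaining points.
\<close>

lemma nn_integral_low_block:
  assumes \<mu>: "real_distribution \<mu>" and Si: "(S, i) \<in> low_blocks n k" and k: "1 \<le> k" "k < n"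
    and T: "T = {1..n} - S"
    and G: "G \<in> borel_measurable (borel \<Otimes>\<^sub>M (\<Pi>\<^sub>M j\<in>T. borel))"
  shows "(\<integral>\<^sup>+y. (if is_low_block n y S i then G (y i, restrict y T) else 0) \<partial>PiM {1..n} (\<lambda>_. \<mu>))
    = (\<integral>\<^sup>+s. (if \<forall>j\<in>S. s j \<le> s i
        then emeasure \<mu> {s i<..} ^ card T * (\<integral>\<^sup>+v. G (s i, sample_above \<mu> T (s i) v) \<partial>PiM T (\<lambda>_. unif))
        else 0) \<partial>PiM S (\<lambda>_. \<mu>))"
proof -
  interpret \<mu>: real_distribution \<mu> by fact
  interpret P: product_sigma_finite "\<lambda>_. \<mu>"
    by (rule product_sigma_finite_prob) (rule \<mu>.prob_space_axioms)
  have S: "S \<subseteq> {1..n}" "card S = k" "i \<in> S" "i \<in> {1..n}" using Si by (auto simp: low_blocks_def)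
  have finS: "finite S" using S(1) finite_subset by blast
  have finT: "finite T" using T by simp
  have disj: "S \<inter> T = {}" and un: "S \<union> T = {1..n}" using S T by auto
  have ne: "T \<noteq> {}"
  proof
    assume "T = {}"
    then have "S = {1..n}" using un by simp
    then show False using S(2) k by simp
  qed
  let ?f = "\<lambda>y. if is_low_block n y S i then G (y i, restrict y T) else 0"
  have f: "?f \<in> borel_measurable (PiM (S \<union> T) (\<lambda>_. \<mu>))"
    unfolding un measurable_cong_sets[OF sets_PiM_law[OF \<mu>] refl]
  proof (rule measurable_If)
    show "(\<lambda>y. G (y i, restrict y T)) \<in> borel_measurable (\<Pi>\<^sub>M i\<in>{1..n}. borel)"
      by (rule measurable_compose[OF measurable_Pair G])
        (use S un in \<open>auto intro!: measurable_component_singleton measurable_restrict_subset\<close>)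
    show "{y \<in> space (\<Pi>\<^sub>M i\<in>{1..n}. borel). is_low_block n y S i} \<in> sets (\<Pi>\<^sub>M i\<in>{1..n}. borel)"
      by (rule sets_is_low_block[OF S(1,4)])
  qed simp
  have "(\<integral>\<^sup>+y. ?f y \<partial>PiM {1..n} (\<lambda>_. \<mu>))
    = (\<integral>\<^sup>+s. (\<integral>\<^sup>+t. ?f (merge S T (s, t)) \<partial>PiM T (\<lambda>_. \<mu>)) \<partial>PiM S (\<lambda>_. \<mu>))"
    using P.product_nn_integral_fold[OF disj finS finT f] un by simp
  also have "\<dots> = (\<integral>\<^sup>+s. (if \<forall>j\<in>S. s j \<le> s i
        then emeasure \<mu> {s i<..} ^ card T * (\<integral>\<^sup>+v. G (s i, sample_above \<mu> T (s i) v) \<partial>PiM T (\<lambda>_. unif))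
        else 0) \<partial>PiM S (\<lambda>_. \<mu>))"
  proof (rule nn_integral_cong)
    fix s assume "s \<in> space (PiM S (\<lambda>_. \<mu>))"
    have low: "is_low_block n (merge S T (s, t)) S i \<longleftrightarrow> (\<forall>j\<in>S. s j \<le> s i) \<and> (\<forall>j\<in>T. s i < t j)" for t
    proof -
      have "is_low_block n (merge S T (s, t)) S i \<longleftrightarrow>
        (\<forall>j\<in>S \<union> T. j \<in> S \<longleftrightarrow> merge S T (s, t) j \<le> merge S T (s, t) i)"
        using S(1) by (auto simp: is_low_block_def un)
      also have "\<dots> \<longleftrightarrow> (\<forall>j\<in>S. s j \<le> s i) \<and> (\<forall>j\<in>T. s i < t j)"
        using S(3) disj by (auto simp: merge_def ball_Un not_le[symmetric])
      finally show ?thesis .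
    qed
    have "(\<integral>\<^sup>+t. ?f (merge S T (s, t)) \<partial>PiM T (\<lambda>_. \<mu>)) =
      (\<integral>\<^sup>+t. (if \<forall>j\<in>S. s j \<le> s i then G (s i, t) * indicator (\<Pi>\<^sub>E j\<in>T. {s i<..}) t else 0) \<partial>PiM T (\<lambda>_. \<mu>))"
    proof (rule nn_integral_cong)
      fix t assume "t \<in> space (PiM T (\<lambda>_. \<mu>))"
      then have t: "t \<in> extensional T" by (simp add: space_PiM PiE_iff)
      then have "restrict (merge S T (s, t)) T = t"
        using disj by (auto simp: merge_def fun_eq_iff extensional_def)
      moreover have "merge S T (s, t) i = s i" using S(3) by (simp add: merge_def)
      moreover have "t \<in> (\<Pi>\<^sub>E j\<in>T. {s i<..}) \<longleftrightarrow> (\<forall>j\<in>T. s i < t j)"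
        using t by (simp add: PiE_iff)
      ultimately show "?f (merge S T (s, t)) =
        (if \<forall>j\<in>S. s j \<le> s i then G (s i, t) * indicator (\<Pi>\<^sub>E j\<in>T. {s i<..}) t else 0)"
        by (simp only: low indicator_def) simp
    qed
    also have "\<dots> = (if \<forall>j\<in>S. s j \<le> s i
        then emeasure \<mu> {s i<..} ^ card T * (\<integral>\<^sup>+v. G (s i, sample_above \<mu> T (s i) v) \<partial>PiM T (\<lambda>_. unif))
        else 0)"
    proof (cases "\<forall>j\<in>S. s j \<le> s i")
      case True
      show ?thesis
        unfolding if_P[OF True]
        by (rule nn_integral_PiM_above[OF \<mu> finT ne measurable_compose[OF measurable_Pair1' G]]) simp
    next
      case False
      show ?thesis unfolding if_not_P[OF False] by simp
    qed
    finally show "(\<integral>\<^sup>+t. ?f (merge S T (s, t)) \<partial>PiM T (\<lambda>_. \<mu>)) = (if \<forall>j\<in>S. s j \<le> s i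
        then emeasure \<mu> {s i<..} ^ card T * (\<integral>\<^sup>+v. G (s i, sample_above \<mu> T (s i) v) \<partial>PiM T (\<lambda>_. unif))
        else 0)" .
  qed
  finally show ?thesis .
qed

lemma borel_measurable_nn_integral_PiM_unif:
  assumes "(\<lambda>(\<omega>, v). f \<omega> v) \<in> borel_measurable (\<Omega> \<Otimes>\<^sub>M (\<Pi>\<^sub>M i\<in>S. borel))"
  shows "(\<lambda>\<omega>. \<integral>\<^sup>+v. f \<omega> v \<partial>PiM S (\<lambda>_. unif)) \<in> borel_measurable \<Omega>"
proof -
  interpret prob_space "PiM S (\<lambda>_. unif)" by (rule prob_space_PiM_unif)
  have sets: "sets (\<Omega> \<Otimes>\<^sub>M PiM S (\<lambda>_. unif)) = sets (\<Omega> \<Otimes>\<^sub>M (\<Pi>\<^sub>M i\<in>S. borel))"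
    by (rule sets_pair_measure_cong[OF refl sets_PiM_unif])
  show ?thesis
    by (rule borel_measurable_nn_integral) (unfold measurable_cong_sets[OF sets refl], rule assms)
qed

lemma sample_above_merge:
  assumes "T \<inter> S = {}" "T \<union> S = I"
  shows "sample_above \<mu> I w (merge T S (v, x)) = merge T S (sample_above \<mu> T w v, sample_above \<mu> S w x)"
  using assms by (auto simp: sample_above_def merge_def fun_eq_iff)

text \<open>
  The new points are assigned to the indices of \<open>S\<close> in an order that depends on \<open>y\<close>. Since the
  uniforms are exchangeable and \<open>y\<close> is fixed here, this order is irrelevant.
\<close>

lemma nn_integral_resample_low_block:
  assumes \<mu>: "real_distribution \<mu>" and y: "y \<in> extensional {1..n}" "inj_on y {1..n}"
    and Si: "(S, i) \<in> low_blocks n k" "is_low_block n y S i" and T: "T = {1..n} - S"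
    and H: "H \<in> borel_measurable (borel \<Otimes>\<^sub>M (\<Pi>\<^sub>M i\<in>{1..n}. borel))"
  shows "(\<integral>\<^sup>+v. H (order_stat n k y, resample \<mu> n k y v) \<partial>PiM {1..k} (\<lambda>_. unif))
    = (\<integral>\<^sup>+v. H (y i, merge T S (restrict y T, sample_above \<mu> S (y i) v)) \<partial>PiM S (\<lambda>_. unif))"
proof -
  let ?r = "inv (sorting_perm n y)"
  note low = is_low_blockD[OF y(2) Si]
  have S: "S \<subseteq> {1..n}" using Si by (auto simp: low_blocks_def)
  have un: "T \<union> S = {1..n}" using S T by auto
  have inj: "inj_on ?r S"
    using permutes_inj_on[OF permutes_inv[OF sorting_perm_permutes]] .
  have r: "?r \<in> S \<rightarrow> {1..k}" using low(2) by blast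
  have "resample \<mu> n k y v = merge T S (restrict y T, sample_above \<mu> S (y i) (\<lambda>j\<in>S. v (?r j)))" for v
  proof
    fix j
    consider "j \<in> S" "j \<in> {1..n}" "j \<notin> T" | "j \<in> T" "j \<in> {1..n}" "j \<notin> S" | "j \<notin> {1..n}" "j \<notin> S" "j \<notin> T"
      using un T by blast
    then show "resample \<mu> n k y v j = merge T S (restrict y T, sample_above \<mu> S (y i) (\<lambda>j\<in>S. v (?r j))) j"
      by cases (simp_all only: resample_def Let_def low(1,2) merge_def sample_above_def restrict_apply if_True if_False prod.case)
  qed
  then have "(\<integral>\<^sup>+v. H (order_stat n k y, resample \<mu> n k y v) \<partial>PiM {1..k} (\<lambda>_. unif))
    = (\<integral>\<^sup>+v. (\<lambda>x. H (y i, merge T S (restrict y T, sample_above \<mu> S (y i) x))) (\<lambda>j\<in>S. v (?r j)) \<partial>PiM {1..k} (\<lambda>_. unif))"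
    by (simp only: low(1))
  also have "\<dots> = (\<integral>\<^sup>+x. H (y i, merge T S (restrict y T, sample_above \<mu> S (y i) x))
      \<partial>distr (PiM {1..k} (\<lambda>_. unif)) (PiM S (\<lambda>_. unif)) (\<lambda>v. \<lambda>j\<in>S. v (?r j)))"
  proof (rule nn_integral_distr[symmetric])
    show "(\<lambda>v. \<lambda>j\<in>S. v (?r j)) \<in> PiM {1..k} (\<lambda>_. unif) \<rightarrow>\<^sub>M PiM S (\<lambda>_. unif)"
      by (intro measurable_restrict measurable_component_singleton) (use r in blast)
    have meas: "(\<lambda>x. (y i, merge T S (restrict y T, sample_above \<mu> S (y i) x))) \<in>
      (\<Pi>\<^sub>M i\<in>S. borel) \<rightarrow>\<^sub>M borel \<Otimes>\<^sub>M (\<Pi>\<^sub>M i\<in>{1..n}. borel)"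
    proof (rule measurable_Pair)
      have "(\<lambda>x. (restrict y T, sample_above \<mu> S (y i) x)) \<in> (\<Pi>\<^sub>M i\<in>S. borel) \<rightarrow>\<^sub>M (\<Pi>\<^sub>M i\<in>T. borel) \<Otimes>\<^sub>M (\<Pi>\<^sub>M i\<in>S. borel)"
        by (intro measurable_Pair measurable_sample_above \<mu> measurable_const measurable_component_singleton)
          (auto simp: space_PiM)
      from measurable_compose[OF this measurable_merge]
      show "(\<lambda>x. merge T S (restrict y T, sample_above \<mu> S (y i) x)) \<in> (\<Pi>\<^sub>M i\<in>S. borel) \<rightarrow>\<^sub>M (\<Pi>\<^sub>M i\<in>{1..n}. borel)"
        unfolding un .
    qed simp
    show "(\<lambda>x. H (y i, merge T S (restrict y T, sample_above \<mu> S (y i) x)))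
      \<in> borel_measurable (distr (PiM {1..k} (\<lambda>_. unif)) (PiM S (\<lambda>_. unif)) (\<lambda>v. \<lambda>j\<in>S. v (?r j)))"
      using measurable_compose[OF meas H]
      by (simp add: measurable_cong_sets[OF sets_PiM_unif refl])
  qed
  also have "distr (PiM {1..k} (\<lambda>_. unif)) (PiM S (\<lambda>_. unif)) (\<lambda>v. \<lambda>j\<in>S. v (?r j)) = PiM S (\<lambda>_. unif)"
    using distr_PiM_reindex[of "{1..k}" "\<lambda>_. unif" ?r S] inj r prob_space_unif by blast
  finally show ?thesis .
qed

text \<open>
  Joint law of level and sample after one step: given the level \<open>w\<close>, the resampled points have the
  same law as a completely fresh i.i.d. sample above \<open>w\<close>. The integral is decomposed over the
  outcomes \<open>(S, i)\<close>. On each of them the points outside \<open>S\<close> are i.i.d. above \<open>w = y i\<close> by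
  \<open>nn_integral_low_block\<close>, and the points in \<open>S\<close> are replaced by fresh ones with this law, so that
  both sides reduce to the same integral.
\<close>

lemma nn_integral_resample:
  assumes \<mu>: "real_distribution \<mu>" and atomless: "\<And>x. emeasure \<mu> {x} = 0"
    and k: "1 \<le> k" "k < n"
    and H: "H \<in> borel_measurable (borel \<Otimes>\<^sub>M (\<Pi>\<^sub>M i\<in>{1..n}. borel))"
  shows "(\<integral>\<^sup>+y. (\<integral>\<^sup>+v. H (order_stat n k y, resample \<mu> n k y v) \<partial>PiM {1..k} (\<lambda>_. unif)) \<partial>PiM {1..n} (\<lambda>_. \<mu>))
    = (\<integral>\<^sup>+y. (\<integral>\<^sup>+v. H (order_stat n k y, sample_above \<mu> {1..n} (order_stat n k y) v) \<partial>PiM {1..n} (\<lambda>_. unif))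
        \<partial>PiM {1..n} (\<lambda>_. \<mu>))"
proof -
  interpret \<mu>: real_distribution \<mu> by fact
  interpret U: product_sigma_finite "\<lambda>_. unif"
    by (rule product_sigma_finite_prob) (rule prob_space_unif)
  have k': "k \<in> {1..n}" using k by simp
  define F where "F y = (\<integral>\<^sup>+v. H (order_stat n k y, resample \<mu> n k y v) \<partial>PiM {1..k} (\<lambda>_. unif))" for y
  define h where "h w = (\<integral>\<^sup>+v. H (w, sample_above \<mu> {1..n} w v) \<partial>PiM {1..n} (\<lambda>_. unif))" for w
  have comp: "(\<lambda>p. snd p l) \<in> borel_measurable (\<Omega> \<Otimes>\<^sub>M (\<Pi>\<^sub>M i\<in>S. borel))" if "l \<in> S"
    for \<Omega> :: "'c measure" and S and l :: nat
    by (rule measurable_compose[OF measurable_snd measurable_component_singleton[OF that]])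
  have Fm: "F \<in> borel_measurable (\<Pi>\<^sub>M i\<in>{1..n}. borel)"
    unfolding F_def case_prod_beta
    by (intro borel_measurable_nn_integral_PiM_unif)
      (unfold case_prod_beta, intro measurable_compose[OF measurable_Pair H]
        measurable_compose[OF measurable_fst measurable_order_stat[OF k']] measurable_resample \<mu> k' measurable_fst comp)
  have hm: "h \<in> borel_measurable borel"
    unfolding h_def
    by (intro borel_measurable_nn_integral_PiM_unif)
      (unfold case_prod_beta, intro measurable_compose[OF measurable_Pair H] measurable_sample_above \<mu> measurable_fst comp)
  have osm: "(\<lambda>y. h (order_stat n k y)) \<in> borel_measurable (\<Pi>\<^sub>M i\<in>{1..n}. borel)"
    by (rule measurable_compose[OF measurable_order_stat[OF k'] hm])
  have inj: "AE y in PiM {1..n} (\<lambda>_. \<mu>). inj_on y {1..n} \<and> y \<in> extensional {1..n}"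
    using AE_PiM_inj_on[OF \<mu> atomless finite_atLeastAtMost] AE_space
    by eventually_elim (simp add: space_PiM PiE_iff)
  have block: "(\<integral>\<^sup>+y. (if is_low_block n y S i then F y else 0) \<partial>PiM {1..n} (\<lambda>_. \<mu>))
    = (\<integral>\<^sup>+y. (if is_low_block n y S i then h (order_stat n k y) else 0) \<partial>PiM {1..n} (\<lambda>_. \<mu>))"
    if Si: "(S, i) \<in> low_blocks n k" for S i
  proof -
    define T where "T = {1..n} - S"
    have S: "S \<subseteq> {1..n}" using Si by (auto simp: low_blocks_def)
    have finS: "finite S" "finite T" using S finite_subset T_def by auto
    have disj: "T \<inter> S = {}" and un: "T \<union> S = {1..n}" using S T_def by auto
    \<comment> \<open>The mean of \<open>H\<close> at level \<open>fst p\<close> when the points outside \<open>S\<close> are \<open>snd p\<close> and those in \<open>S\<close> are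
      fresh.\<close>
    define G where "G p = (\<integral>\<^sup>+v. H (fst p, merge T S (snd p, sample_above \<mu> S (fst p) v)) \<partial>PiM S (\<lambda>_. unif))" for p
    have mm: "(\<lambda>p. merge T S (f p, g p)) \<in> \<Omega> \<rightarrow>\<^sub>M (\<Pi>\<^sub>M i\<in>{1..n}. borel)"
      if "f \<in> \<Omega> \<rightarrow>\<^sub>M (\<Pi>\<^sub>M i\<in>T. borel)" "g \<in> \<Omega> \<rightarrow>\<^sub>M (\<Pi>\<^sub>M i\<in>S. borel)"
      for f g :: "'d \<Rightarrow> nat \<Rightarrow> real" and \<Omega> :: "'d measure"
      using measurable_compose[OF measurable_Pair[OF that] measurable_merge] unfolding un .
    have Gm: "G \<in> borel_measurable (borel \<Otimes>\<^sub>M (\<Pi>\<^sub>M j\<in>T. borel))"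
      unfolding G_def
      by (intro borel_measurable_nn_integral_PiM_unif)
        (unfold case_prod_beta, intro measurable_compose[OF measurable_Pair H] mm measurable_sample_above \<mu>
          comp measurable_compose[OF measurable_fst measurable_fst] measurable_compose[OF measurable_fst measurable_snd])
    have hm': "(\<lambda>p. h (fst p)) \<in> borel_measurable (borel \<Otimes>\<^sub>M (\<Pi>\<^sub>M j\<in>T. borel))"
      by (rule measurable_compose[OF measurable_fst hm])
    have h_eq: "(\<integral>\<^sup>+v. G (w, sample_above \<mu> T w v) \<partial>PiM T (\<lambda>_. unif)) = (\<integral>\<^sup>+v. h w \<partial>PiM T (\<lambda>_. unif))" for w
    proof -
      have "(\<lambda>v. H (w, sample_above \<mu> {1..n} w v)) \<in> borel_measurable (PiM (T \<union> S) (\<lambda>_. unif))"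
        unfolding measurable_cong_sets[OF sets_PiM_unif refl] un
        by (intro measurable_compose[OF measurable_Pair H] measurable_sample_above \<mu> measurable_const
            measurable_component_singleton) simp_all
      note fold = U.product_nn_integral_fold[OF disj finS(2,1) this]
      have "h w = (\<integral>\<^sup>+v. G (w, sample_above \<mu> T w v) \<partial>PiM T (\<lambda>_. unif))"
        using fold by (simp only: h_def G_def un sample_above_merge[OF disj un] fst_conv snd_conv)
      then show ?thesis
        by (simp add: prob_space.emeasure_space_1[OF prob_space_PiM_unif])
    qed
    have "(\<integral>\<^sup>+y. (if is_low_block n y S i then F y else 0) \<partial>PiM {1..n} (\<lambda>_. \<mu>))
      = (\<integral>\<^sup>+y. (if is_low_block n y S i then G (y i, restrict y T) else 0) \<partial>PiM {1..n} (\<lambda>_. \<mu>))"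
    proof (rule nn_integral_cong_AE, use inj in eventually_elim)
      fix y :: "nat \<Rightarrow> real" assume "inj_on y {1..n} \<and> y \<in> extensional {1..n}"
      then show "(if is_low_block n y S i then F y else 0) = (if is_low_block n y S i then G (y i, restrict y T) else 0)"
        using nn_integral_resample_low_block[OF \<mu> _ _ Si _ T_def H, of y]
        by (simp add: F_def G_def)
    qed
    also have "\<dots> = (\<integral>\<^sup>+y. (if is_low_block n y S i then h (fst (y i, restrict y T)) else 0) \<partial>PiM {1..n} (\<lambda>_. \<mu>))"
      using nn_integral_low_block[OF \<mu> Si k T_def Gm] nn_integral_low_block[OF \<mu> Si k T_def hm']
      by (simp only: h_eq fst_conv)
    also have "\<dots> = (\<integral>\<^sup>+y. (if is_low_block n y S i then h (order_stat n k y) else 0) \<partial>PiM {1..n} (\<lambda>_. \<mu>))"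
    proof (rule nn_integral_cong_AE, use inj in eventually_elim)
      fix y :: "nat \<Rightarrow> real" assume "inj_on y {1..n} \<and> y \<in> extensional {1..n}"
      then show "(if is_low_block n y S i then h (fst (y i, restrict y T)) else 0)
        = (if is_low_block n y S i then h (order_stat n k y) else 0)"
        using is_low_blockD(1)[OF _ Si, of y] by simp
    qed
    finally show ?thesis .
  qed
  have decomp: "(\<integral>\<^sup>+y. f y \<partial>PiM {1..n} (\<lambda>_. \<mu>))
    = (\<Sum>(S, i)\<in>low_blocks n k. \<integral>\<^sup>+y. (if is_low_block n y S i then f y else 0) \<partial>PiM {1..n} (\<lambda>_. \<mu>))"
    if f: "f \<in> borel_measurable (\<Pi>\<^sub>M i\<in>{1..n}. borel)" for f :: "(nat \<Rightarrow> real) \<Rightarrow> ennreal"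
  proof -
    have "(\<integral>\<^sup>+y. f y \<partial>PiM {1..n} (\<lambda>_. \<mu>))
      = (\<integral>\<^sup>+y. (\<Sum>p\<in>low_blocks n k. if is_low_block n y (fst p) (snd p) then f y else 0) \<partial>PiM {1..n} (\<lambda>_. \<mu>))"
      using inj by (intro nn_integral_cong_AE, eventually_elim)
        (use sum_low_blocks[OF _ k'] in \<open>simp add: case_prod_beta\<close>)
    also have "\<dots> = (\<Sum>p\<in>low_blocks n k. \<integral>\<^sup>+y. (if is_low_block n y (fst p) (snd p) then f y else 0) \<partial>PiM {1..n} (\<lambda>_. \<mu>))"
    proof (rule nn_integral_sum)
      fix p assume p: "p \<in> low_blocks n k"
      show "(\<lambda>y. if is_low_block n y (fst p) (snd p) then f y else 0) \<in> borel_measurable (PiM {1..n} (\<lambda>_. \<mu>))"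
        unfolding measurable_cong_sets[OF sets_PiM_law[OF \<mu>] refl]
        by (rule measurable_If[OF f _ sets_is_low_block]) (use p in \<open>auto simp: low_blocks_def\<close>)
    qed
    finally show ?thesis by (simp add: case_prod_beta)
  qed
  have "(\<integral>\<^sup>+y. F y \<partial>PiM {1..n} (\<lambda>_. \<mu>)) = (\<integral>\<^sup>+y. h (order_stat n k y) \<partial>PiM {1..n} (\<lambda>_. \<mu>))"
    unfolding decomp[OF Fm] decomp[OF osm] by (rule sum.cong) (use block in auto)
  then show ?thesis by (simp only: F_def h_def)
qed

section \<open>Independence of fresh inputs and conditioning twice\<close>

text \<open>
  Relabelling an independent family along an injection; used to read off the initial sample and
  the uniforms of one iteration from the single family of all inputs.
\<close>

lemma (in prob_space) distr_indep_vars_reindex: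
  fixes V :: "'i \<Rightarrow> 'a \<Rightarrow> real" and h :: "'k \<Rightarrow> 'i"
  assumes indep: "indep_vars (\<lambda>_. borel) V I" and h: "h ` K \<subseteq> I" "inj_on h K" and K: "K \<noteq> {}"
  shows "distr M (\<Pi>\<^sub>M l\<in>K. borel) (\<lambda>\<omega>. \<lambda>l\<in>K. V (h l) \<omega>) = (\<Pi>\<^sub>M l\<in>K. distr M borel (V (h l)))"
proof -
  let ?L = "\<lambda>i. distr M borel (V i)"
  have rv: "random_variable borel (V i)" if "i \<in> h ` K" for i
    using indep h that by (auto simp: indep_vars_def)
  have "indep_vars (\<lambda>_. borel) V (h ` K)"
    using indep_vars_subset[OF indep h(1)] .
  then have joint: "distr M (\<Pi>\<^sub>M i\<in>h ` K. borel) (\<lambda>\<omega>. \<lambda>i\<in>h ` K. V i \<omega>) = PiM (h ` K) ?L"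
    using indep_vars_iff_distr_eq_PiM'[where I="h ` K" and M'="\<lambda>_. borel" and X=V] rv K by auto
  have sets: "sets (\<Pi>\<^sub>M l\<in>K. ?L (h l)) = sets (\<Pi>\<^sub>M l\<in>K. borel)"
    by (rule sets_PiM_cong) auto
  have "(\<Pi>\<^sub>M l\<in>K. ?L (h l)) = distr (PiM (h ` K) ?L) (\<Pi>\<^sub>M l\<in>K. ?L (h l)) (\<lambda>\<omega>. \<lambda>l\<in>K. \<omega> (h l))"
    by (rule distr_PiM_reindex[symmetric]) (use h rv in \<open>auto intro: prob_space_distr\<close>)
  also have "\<dots> = distr (PiM (h ` K) ?L) (\<Pi>\<^sub>M l\<in>K. borel) (\<lambda>\<omega>. \<lambda>l\<in>K. \<omega> (h l))"
    by (rule distr_cong) (auto simp: sets)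
  also have "\<dots> = distr M (\<Pi>\<^sub>M l\<in>K. borel) ((\<lambda>\<omega>. \<lambda>l\<in>K. \<omega> (h l)) \<circ> (\<lambda>\<omega>. \<lambda>i\<in>h ` K. V i \<omega>))"
    unfolding joint[symmetric]
  proof (rule distr_distr)
    show "(\<lambda>\<omega>. \<lambda>l\<in>K. \<omega> (h l)) \<in> (\<Pi>\<^sub>M i\<in>h ` K. (borel :: real measure)) \<rightarrow>\<^sub>M (\<Pi>\<^sub>M l\<in>K. borel)"
      by (intro measurable_restrict measurable_component_singleton) auto
    show "(\<lambda>\<omega>. \<lambda>i\<in>h ` K. V i \<omega>) \<in> M \<rightarrow>\<^sub>M (\<Pi>\<^sub>M i\<in>h ` K. borel)"
      by (intro measurable_restrict rv)
  qed
  also have "((\<lambda>\<omega>. \<lambda>l\<in>K. \<omega> (h l)) \<circ> (\<lambda>\<omega>. \<lambda>i\<in>h ` K. V i \<omega>)) = (\<lambda>\<omega>. \<lambda>l\<in>K. V (h l) \<omega>)"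
    by (auto simp: fun_eq_iff)
  finally show ?thesis ..
qed

text \<open>
  Inputs that are independent of the past may be integrated out first, with the past held fixed.
\<close>

lemma (in prob_space) nn_integral_indep_block:
  fixes V :: "'i \<Rightarrow> 'a \<Rightarrow> real" and h :: "'k \<Rightarrow> 'i"
  assumes indep: "indep_vars (\<lambda>_. borel) V I" and h: "h ` K \<subseteq> I" "inj_on h K" and K: "K \<noteq> {}"
    and A: "A \<subseteq> I" "A \<inter> h ` K = {}"
    and law: "\<And>l. l \<in> K \<Longrightarrow> distr M borel (V (h l)) = L"
    and \<Phi>: "\<Phi> \<in> borel_measurable ((\<Pi>\<^sub>M i\<in>A. borel) \<Otimes>\<^sub>M (\<Pi>\<^sub>M l\<in>K. borel))"
  shows "(\<integral>\<^sup>+\<omega>. \<Phi> (\<lambda>i\<in>A. V i \<omega>, \<lambda>l\<in>K. V (h l) \<omega>) \<partial>M)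
    = (\<integral>\<^sup>+\<omega>. (\<integral>\<^sup>+v. \<Phi> (\<lambda>i\<in>A. V i \<omega>, v) \<partial>PiM K (\<lambda>_. L)) \<partial>M)"
proof -
  let ?A = "\<Pi>\<^sub>M i\<in>A. (borel :: real measure)" and ?B = "\<Pi>\<^sub>M i\<in>h ` K. (borel :: real measure)"
    and ?K = "\<Pi>\<^sub>M l\<in>K. (borel :: real measure)"
  let ?past = "\<lambda>\<omega>. \<lambda>i\<in>A. V i \<omega>" and ?new = "\<lambda>\<omega>. \<lambda>i\<in>h ` K. V i \<omega>"
  let ?t = "\<lambda>v :: 'i \<Rightarrow> real. \<lambda>l\<in>K. v (h l)"
  have "indep_var ?A ?past ?B ?new"
    using indep_var_restrict[OF indep A(2,1) h(1)] .
  then have past: "?past \<in> M \<rightarrow>\<^sub>M ?A" and new: "?new \<in> M \<rightarrow>\<^sub>M ?B"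
    and joint: "distr M ?A ?past \<Otimes>\<^sub>M distr M ?B ?new = distr M (?A \<Otimes>\<^sub>M ?B) (\<lambda>\<omega>. (?past \<omega>, ?new \<omega>))"
    by (simp_all add: indep_var_distribution_eq)
  have t: "?t \<in> ?B \<rightarrow>\<^sub>M ?K"
    by (intro measurable_restrict measurable_component_singleton) auto
  have t_new: "?t (?new \<omega>) = (\<lambda>l\<in>K. V (h l) \<omega>)" for \<omega>
    by (auto simp: fun_eq_iff)
  have new_law: "distr (distr M ?B ?new) ?K ?t = PiM K (\<lambda>_. L)"
    unfolding distr_distr[OF t new] comp_def t_new distr_indep_vars_reindex[OF indep h K]
    by (rule PiM_cong) (auto simp: law)
  interpret new: prob_space "distr M ?B ?new" by (rule prob_space_distr[OF new])
  have \<Phi>': "(\<lambda>p. \<Phi> (fst p, ?t (snd p))) \<in> borel_measurable (?A \<Otimes>\<^sub>M ?B)"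
    by (intro measurable_compose[OF measurable_Pair \<Phi>] measurable_fst measurable_compose[OF measurable_snd t])
  have "(\<integral>\<^sup>+\<omega>. \<Phi> (?past \<omega>, ?t (?new \<omega>)) \<partial>M)
    = (\<integral>\<^sup>+p. \<Phi> (fst p, ?t (snd p)) \<partial>(distr M ?A ?past \<Otimes>\<^sub>M distr M ?B ?new))"
    unfolding joint by (subst nn_integral_distr[OF measurable_Pair[OF past new]]) (use \<Phi>' in simp_all)
  also have "\<dots> = (\<integral>\<^sup>+p. (\<integral>\<^sup>+v. \<Phi> (p, ?t v) \<partial>distr M ?B ?new) \<partial>distr M ?A ?past)"
  proof (subst new.nn_integral_fst[symmetric])
    have "sets (distr M ?A ?past \<Otimes>\<^sub>M distr M ?B ?new) = sets (?A \<Otimes>\<^sub>M ?B)"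
      by (rule sets_pair_measure_cong) simp_all
    note cong = measurable_cong_sets[OF this refl]
    show "(\<lambda>p. \<Phi> (fst p, ?t (snd p))) \<in> borel_measurable (distr M ?A ?past \<Otimes>\<^sub>M distr M ?B ?new)"
      unfolding cong by (rule \<Phi>')
  qed simp
  also have "\<dots> = (\<integral>\<^sup>+\<omega>. (\<integral>\<^sup>+v. \<Phi> (?past \<omega>, ?t v) \<partial>distr M ?B ?new) \<partial>M)"
  proof (rule nn_integral_distr[OF past])
    have "sets (?A \<Otimes>\<^sub>M distr M ?B ?new) = sets (?A \<Otimes>\<^sub>M ?B)"
      by (rule sets_pair_measure_cong) simp_all
    note cong = measurable_cong_sets[OF this refl]
    have "(\<lambda>(p, v). \<Phi> (p, ?t v)) \<in> borel_measurable (?A \<Otimes>\<^sub>M distr M ?B ?new)"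
      unfolding cong case_prod_unfold by (rule \<Phi>')
    from new.borel_measurable_nn_integral[OF this]
    show "(\<lambda>p. \<integral>\<^sup>+v. \<Phi> (p, ?t v) \<partial>distr M ?B ?new) \<in> borel_measurable (distr M ?A ?past)"
      by simp
  qed
  also have "\<dots> = (\<integral>\<^sup>+\<omega>. (\<integral>\<^sup>+v. \<Phi> (?past \<omega>, v) \<partial>PiM K (\<lambda>_. L)) \<partial>M)"
  proof (rule nn_integral_cong)
    fix \<omega>
    have "(\<lambda>v. \<Phi> (?past \<omega>, v)) \<in> borel_measurable ?K"
      by (rule measurable_compose[OF measurable_Pair1' \<Phi>]) (auto simp: space_PiM)
    then show "(\<integral>\<^sup>+v. \<Phi> (?past \<omega>, ?t v) \<partial>distr M ?B ?new) = (\<integral>\<^sup>+v. \<Phi> (?past \<omega>, v) \<partial>PiM K (\<lambda>_. L))"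
      unfolding new_law[symmetric] by (subst nn_integral_distr) (use t in simp_all)
  qed
  finally show ?thesis unfolding t_new .
qed

text \<open>
  Conditioning on exceeding \<open>z\<close> and then a higher level \<open>w\<close> is conditioning on exceeding \<open>w\<close>. If
  there is no mass above \<open>w\<close>, both sides are the zero measure.
\<close>

lemma cond_law_cond_law:
  assumes \<mu>: "real_distribution \<mu>" and z: "emeasure \<mu> {z<..} \<noteq> 0" and "z \<le> w"
  shows "cond_law (cond_law \<mu> z) w = cond_law \<mu> w"
proof (rule measure_eqI)
  interpret real_distribution \<mu> by fact
  show "sets (cond_law (cond_law \<mu> z) w) = sets (cond_law \<mu> w)" by simp
  fix B assume "B \<in> sets (cond_law (cond_law \<mu> z) w)"
  then have B: "B \<in> sets borel" by simp
  have eq: "{z<..} \<inter> ({w<..} \<inter> B) = {w<..} \<inter> B" "{z<..} \<inter> {w<..} = {w<..}"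
    using \<open>z \<le> w\<close> by auto
  have ez: "emeasure (cond_law \<mu> z) ({w<..} \<inter> B) = emeasure \<mu> ({w<..} \<inter> B) / emeasure \<mu> {z<..}"
    "emeasure (cond_law \<mu> z) {w<..} = emeasure \<mu> {w<..} / emeasure \<mu> {z<..}"
    unfolding cond_law_def using B by (simp_all add: eq)
  have pz: "0 < prob {z<..}" using z by (simp add: emeasure_eq_measure zero_less_measure_iff)
  have "emeasure (cond_law (cond_law \<mu> z) w) B
    = (emeasure \<mu> ({w<..} \<inter> B) / emeasure \<mu> {z<..}) / (emeasure \<mu> {w<..} / emeasure \<mu> {z<..})"
    unfolding ez[symmetric] by (subst cond_law_def) (use B in simp)
  also have "\<dots> = emeasure \<mu> ({w<..} \<inter> B) / emeasure \<mu> {w<..}"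
  proof (cases "emeasure \<mu> {w<..} = 0")
    case True
    then have "emeasure \<mu> ({w<..} \<inter> B) = 0"
      using emeasure_mono[of "{w<..} \<inter> B" "{w<..}" \<mu>] by simp
    with True show ?thesis by simp
  next
    case False
    then have "0 < prob {w<..}" by (simp add: emeasure_eq_measure zero_less_measure_iff)
    with pz show ?thesis by (simp add: emeasure_eq_measure divide_ennreal)
  qed
  also have "\<dots> = emeasure (cond_law \<mu> w) B" unfolding cond_law_def using B by simp
  finally show "emeasure (cond_law (cond_law \<mu> z) w) B = emeasure (cond_law \<mu> w) B" .
qed

lemma atomless_cond_law:
  assumes "real_distribution \<mu>" "\<And>x. emeasure \<mu> {x} = 0"
  shows "emeasure (cond_law \<mu> z) {x} = 0"
proof -
  interpret real_distribution \<mu> by fact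
  have "emeasure \<mu> ({z<..} \<inter> {x}) = 0"
    using emeasure_mono[of "{z<..} \<inter> {x}" "{x}" \<mu>] assms(2)[of x] by simp
  then show ?thesis by (simp add: cond_law_def)
qed

lemma AE_order_stat_above:
  assumes \<mu>: "real_distribution \<mu>" and z: "emeasure \<mu> {z<..} \<noteq> 0" and k: "k \<in> {1..n}"
  shows "AE y in PiM {1..n} (\<lambda>_. cond_law \<mu> z). z < order_stat n k y"
proof -
  interpret c: real_distribution "cond_law \<mu> z" by (rule real_distribution_cond_law[OF \<mu> z])
  interpret real_distribution \<mu> by fact
  have "AE t in cond_law \<mu> z. z < t"
    unfolding cond_law_def by (rule AE_uniform_measureI) auto
  then have "AE y in PiM {1..n} (\<lambda>_. cond_law \<mu> z). z < y i" if "i \<in> {1..n}" for i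
    using that by (intro AE_PiM_component) (auto simp: c.prob_space_axioms)
  then have "AE y in PiM {1..n} (\<lambda>_. cond_law \<mu> z). \<forall>i\<in>{1..n}. z < y i"
    by (intro AE_finite_allI) auto
  then show ?thesis
  proof eventually_elim
    case (elim y)
    then show ?case using order_stat_in_range[OF k, of y] by metis
  qed
qed

lemma resample_cong:
  assumes "\<And>i. i \<in> {1..n} \<Longrightarrow> y i = y' i" and "\<And>l. l \<in> {1..k} \<Longrightarrow> v l = v' l" and "k \<in> {1..n}"
  shows "resample \<mu> n k y v = resample \<mu> n k y' v'"
proof -
  have eq: "sorting_perm n y = sorting_perm n y'" "order_stat n k y = order_stat n k y'"
    by (rule sorting_perm_cong[OF assms(1)], assumption, rule order_stat_cong[OF assms(1,3)])
  show ?thesis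
    unfolding resample_def Let_def eq
  proof (rule restrict_ext)
    fix i assume i: "i \<in> {1..n}"
    show "(if inv (sorting_perm n y') i \<in> {1..k}
        then quantile_above \<mu> (order_stat n k y') (v (inv (sorting_perm n y') i)) else y i)
      = (if inv (sorting_perm n y') i \<in> {1..k}
        then quantile_above \<mu> (order_stat n k y') (v' (inv (sorting_perm n y') i)) else y' i)"
      by (cases "inv (sorting_perm n y') i \<in> {1..k}") (simp_all only: if_True if_False assms(1)[OF i] assms(2))
  qed
qed

text \<open>
  The one-step result started from the conditional law above \<open>z\<close>. The new points are then drawn
  relative to \<open>\<mu>\<close> itself, which agrees with drawing relative to the conditional law because the new
  level almost surely exceeds \<open>z\<close>.
\<close>

lemma nn_integral_resample_above:
  assumes \<mu>: "real_distribution \<mu>" and atomless: "\<And>x. emeasure \<mu> {x} = 0"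
    and k: "1 \<le> k" "k < n" and z: "emeasure \<mu> {z<..} \<noteq> 0"
    and H: "H \<in> borel_measurable (borel \<Otimes>\<^sub>M (\<Pi>\<^sub>M i\<in>{1..n}. borel))"
  shows "(\<integral>\<^sup>+y. (\<integral>\<^sup>+v. H (order_stat n k y, resample \<mu> n k y v) \<partial>PiM {1..k} (\<lambda>_. unif))
        \<partial>PiM {1..n} (\<lambda>_. cond_law \<mu> z))
    = (\<integral>\<^sup>+y. (\<integral>\<^sup>+v. H (order_stat n k y, sample_above \<mu> {1..n} (order_stat n k y) v) \<partial>PiM {1..n} (\<lambda>_. unif))
        \<partial>PiM {1..n} (\<lambda>_. cond_law \<mu> z))"
proof -
  let ?P = "PiM {1..n} (\<lambda>_. cond_law \<mu> z)"
  have k': "k \<in> {1..n}" using k by simp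
  have above: "AE y in ?P. z < order_stat n k y" by (rule AE_order_stat_above[OF \<mu> z k'])
  have "(\<integral>\<^sup>+y. (\<integral>\<^sup>+v. H (order_stat n k y, resample \<mu> n k y v) \<partial>PiM {1..k} (\<lambda>_. unif)) \<partial>?P)
    = (\<integral>\<^sup>+y. (\<integral>\<^sup>+v. H (order_stat n k y, resample (cond_law \<mu> z) n k y v) \<partial>PiM {1..k} (\<lambda>_. unif)) \<partial>?P)"
    by (rule nn_integral_cong_AE, use above in eventually_elim)
      (simp only: resample_def cond_law_cond_law[OF \<mu> z less_imp_le])
  also have "\<dots> = (\<integral>\<^sup>+y. (\<integral>\<^sup>+v. H (order_stat n k y, sample_above (cond_law \<mu> z) {1..n} (order_stat n k y) v)
      \<partial>PiM {1..n} (\<lambda>_. unif)) \<partial>?P)"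
    by (rule nn_integral_resample[OF real_distribution_cond_law[OF \<mu> z] atomless_cond_law[OF \<mu> atomless] k H])
  also have "\<dots> = (\<integral>\<^sup>+y. (\<integral>\<^sup>+v. H (order_stat n k y, sample_above \<mu> {1..n} (order_stat n k y) v)
      \<partial>PiM {1..n} (\<lambda>_. unif)) \<partial>?P)"
    by (rule nn_integral_cong_AE, use above in eventually_elim)
      (simp only: sample_above_def cond_law_cond_law[OF \<mu> z less_imp_le])
  finally show ?thesis .
qed

section \<open>The particle system given its current level\<close>

text \<open>
  The particles as a point of the product space over the index range.
\<close>

definition cloud ::
  "real measure \<Rightarrow> nat \<Rightarrow> nat \<Rightarrow> (nat \<Rightarrow> real) \<Rightarrow> (nat \<Rightarrow> nat \<Rightarrow> real) \<Rightarrow> nat \<Rightarrow> nat \<Rightarrow> real" where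
  "cloud \<mu> n k x0 u j = restrict (ams_particles \<mu> n k x0 u j) {1..n}"

text \<open>
  Iteration \<open>j\<close> is reached: all of the levels \<open>Z\<^sup>1, \<dots>, Z\<^sup>j\<close> are below \<open>a\<close>. The initial level \<open>x\<close> is
  not among them, as the stopping rule looks at \<open>Z\<^sup>1\<close> first; the case \<open>x = a\<close> is thus covered.
\<close>

definition running ::
  "real measure \<Rightarrow> nat \<Rightarrow> nat \<Rightarrow> real \<Rightarrow> (nat \<Rightarrow> real) \<Rightarrow> (nat \<Rightarrow> nat \<Rightarrow> real) \<Rightarrow> nat \<Rightarrow> bool" where
  "running \<mu> n k a x0 u j \<longleftrightarrow> (\<forall>i<j. order_stat n k (cloud \<mu> n k x0 u i) < a)"

lemma cloud_0: "cloud \<mu> n k x0 u 0 = restrict x0 {1..n}"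
  by (simp add: cloud_def)

lemma cloud_Suc:
  assumes k: "k \<in> {1..n}"
  shows "cloud \<mu> n k x0 u (Suc j) = resample \<mu> n k (cloud \<mu> n k x0 u j) (u (Suc j))"
proof -
  have "cloud \<mu> n k x0 u (Suc j) = resample \<mu> n k (ams_particles \<mu> n k x0 u j) (u (Suc j))"
    unfolding cloud_def resample_def ams_particles.simps Let_def ..
  also have "\<dots> = resample \<mu> n k (cloud \<mu> n k x0 u j) (u (Suc j))"
    by (rule resample_cong) (simp_all only: cloud_def restrict_apply if_True k)
  finally show ?thesis .
qed

lemma cloud_cong:
  assumes k: "k \<in> {1..n}" and "\<And>i. i \<in> {1..n} \<Longrightarrow> x0 i = x0' i"
    and "\<And>i l. i \<in> {1..j} \<Longrightarrow> l \<in> {1..k} \<Longrightarrow> u i l = u' i l"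
  shows "cloud \<mu> n k x0 u j = cloud \<mu> n k x0' u' j"
  using assms(3)
proof (induction j)
  case 0
  show ?case unfolding cloud_0 by (rule restrict_ext) (rule assms(2))
next
  case (Suc j)
  have "cloud \<mu> n k x0 u j = cloud \<mu> n k x0' u' j"
    by (rule Suc.IH) (rule Suc.prems, auto)
  moreover have "u (Suc j) l = u' (Suc j) l" if "l \<in> {1..k}" for l
    using Suc.prems[of "Suc j" l] that by simp
  ultimately show ?case unfolding cloud_Suc[OF k] using resample_cong[OF _ _ k] by metis
qed

lemma running_cong:
  assumes k: "k \<in> {1..n}" and "\<And>i. i \<in> {1..n} \<Longrightarrow> x0 i = x0' i"
    and "\<And>i l. i \<in> {1..j} \<Longrightarrow> l \<in> {1..k} \<Longrightarrow> u i l = u' i l"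
  shows "running \<mu> n k a x0 u j = running \<mu> n k a x0' u' j"
proof -
  have "cloud \<mu> n k x0 u i = cloud \<mu> n k x0' u' i" if "i < j" for i
    by (rule cloud_cong[OF k assms(2)]) (use assms(3) that in auto)
  then show ?thesis by (simp add: running_def)
qed

lemma ams_level_0: "ams_level \<mu> n k x x0 u 0 = x"
  by (simp add: ams_level_def)

lemma ams_level_Suc:
  assumes "k \<in> {1..n}"
  shows "ams_level \<mu> n k x x0 u (Suc j) = order_stat n k (cloud \<mu> n k x0 u j)"
  unfolding ams_level_def cloud_def nat.case
  by (rule order_stat_cong[OF _ assms]) (simp only: restrict_apply if_True)

lemma measurable_cloud:
  assumes \<mu>: "real_distribution \<mu>" and k: "k \<in> {1..n}"
    and x0: "\<And>i. i \<in> {1..n} \<Longrightarrow> (\<lambda>\<omega>. x0 \<omega> i) \<in> borel_measurable \<Omega>"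
    and u: "\<And>i l. i \<in> {1..j} \<Longrightarrow> l \<in> {1..k} \<Longrightarrow> (\<lambda>\<omega>. u \<omega> i l) \<in> borel_measurable \<Omega>"
  shows "(\<lambda>\<omega>. cloud \<mu> n k (x0 \<omega>) (u \<omega>) j) \<in> \<Omega> \<rightarrow>\<^sub>M (\<Pi>\<^sub>M i\<in>{1..n}. borel)"
  using u
proof (induction j)
  case 0
  show ?case unfolding cloud_0 by (intro measurable_restrict x0)
next
  case (Suc j)
  show ?case unfolding cloud_Suc[OF k]
  proof (rule measurable_resample[OF \<mu> k])
    show "(\<lambda>\<omega>. cloud \<mu> n k (x0 \<omega>) (u \<omega>) j) \<in> \<Omega> \<rightarrow>\<^sub>M (\<Pi>\<^sub>M i\<in>{1..n}. borel)"
      by (rule Suc.IH) (rule Suc.prems, auto)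
  qed (rule Suc.prems, simp_all)
qed

lemma sets_running:
  assumes \<mu>: "real_distribution \<mu>" and k: "k \<in> {1..n}"
    and x0: "\<And>i. i \<in> {1..n} \<Longrightarrow> (\<lambda>\<omega>. x0 \<omega> i) \<in> borel_measurable \<Omega>"
    and u: "\<And>i l. i \<in> {1..j} \<Longrightarrow> l \<in> {1..k} \<Longrightarrow> (\<lambda>\<omega>. u \<omega> i l) \<in> borel_measurable \<Omega>"
  shows "{\<omega> \<in> space \<Omega>. running \<mu> n k a (x0 \<omega>) (u \<omega>) j} \<in> sets \<Omega>"
proof -
  have "{\<omega> \<in> space \<Omega>. \<forall>i\<in>{..<j}. order_stat n k (cloud \<mu> n k (x0 \<omega>) (u \<omega>) i) < a} \<in> sets \<Omega>"
  proof (intro sets.sets_Collect_finite_All finite_lessThan)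
    fix i assume "i \<in> {..<j}"
    then have "(\<lambda>\<omega>. cloud \<mu> n k (x0 \<omega>) (u \<omega>) i) \<in> \<Omega> \<rightarrow>\<^sub>M (\<Pi>\<^sub>M i\<in>{1..n}. borel)"
      by (intro measurable_cloud[OF \<mu> k] x0 u) auto
    from measurable_compose[OF this measurable_order_stat[OF k]]
    show "{\<omega> \<in> space \<Omega>. order_stat n k (cloud \<mu> n k (x0 \<omega>) (u \<omega>) i) < a} \<in> sets \<Omega>"
      by (rule borel_measurable_less) simp
  qed
  then show ?thesis by (simp only: running_def Ball_def lessThan_iff)
qed

text \<open>
  The random inputs of the algorithm, for a law given abstractly by a measure on the reals.
\<close>

locale ams_run = prob_space N for N :: "'b measure" +
  fixes \<mu> :: "real measure" and n k :: nat and a x :: real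
    and X0 :: "nat \<Rightarrow> 'b \<Rightarrow> real" and U :: "nat \<Rightarrow> nat \<Rightarrow> 'b \<Rightarrow> real"
  assumes \<mu>: "real_distribution \<mu>" and atomless: "\<And>t. emeasure \<mu> {t} = 0"
    and k: "1 \<le> k" "k < n"
    and above_a: "emeasure \<mu> {a<..} \<noteq> 0" and x_le: "x \<le> a"
    and indep: "indep_vars (\<lambda>_. borel) (case_sum X0 (\<lambda>(j, l). U j l)) ({1..n} <+> ({1..} \<times> {1..k}))"
    and law_X0: "\<And>i. i \<in> {1..n} \<Longrightarrow> distr N borel (X0 i) = cond_law \<mu> x"
    and law_U: "\<And>j l. 1 \<le> j \<Longrightarrow> l \<in> {1..k} \<Longrightarrow> distr N borel (U j l) = unif"
begin

lemma k_in: "k \<in> {1..n}" using k by simp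

abbreviation cloud_at :: "nat \<Rightarrow> 'b \<Rightarrow> nat \<Rightarrow> real" where
  "cloud_at j \<omega> \<equiv> cloud \<mu> n k (\<lambda>i. X0 i \<omega>) (\<lambda>j l. U j l \<omega>) j"

abbreviation level_at :: "nat \<Rightarrow> 'b \<Rightarrow> real" where
  "level_at j \<omega> \<equiv> ams_level \<mu> n k x (\<lambda>i. X0 i \<omega>) (\<lambda>j l. U j l \<omega>) j"

abbreviation running_at :: "nat \<Rightarrow> 'b \<Rightarrow> bool" where
  "running_at j \<omega> \<equiv> running \<mu> n k a (\<lambda>i. X0 i \<omega>) (\<lambda>j l. U j l \<omega>) j"

lemma measurable_X0: "i \<in> {1..n} \<Longrightarrow> X0 i \<in> borel_measurable N"
  using indep by (force simp: indep_vars_def)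

lemma measurable_U: "1 \<le> j \<Longrightarrow> l \<in> {1..k} \<Longrightarrow> U j l \<in> borel_measurable N"
  using indep by (force simp: indep_vars_def)

lemma measurable_cloud_at: "cloud_at j \<in> N \<rightarrow>\<^sub>M (\<Pi>\<^sub>M i\<in>{1..n}. borel)"
  by (rule measurable_cloud[OF \<mu> k_in]) (auto intro: measurable_X0 measurable_U)

lemma sets_running_at: "{\<omega> \<in> space N. running_at j \<omega>} \<in> sets N"
  by (rule sets_running[OF \<mu> k_in]) (auto intro: measurable_X0 measurable_U)

lemma measurable_level_at: "level_at j \<in> borel_measurable N"
proof (cases j)
  case 0
  then show ?thesis by (simp add: ams_level_0)
next
  case (Suc i)
  show ?thesis unfolding Suc ams_level_Suc[OF k_in]
    by (rule measurable_compose[OF measurable_cloud_at measurable_order_stat[OF k_in]])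
qed

lemma running_at_Suc: "running_at (Suc j) \<omega> \<longleftrightarrow> running_at j \<omega> \<and> order_stat n k (cloud_at j \<omega>) < a"
  by (auto simp: running_def less_Suc_eq)

lemma level_at_le: "running_at j \<omega> \<Longrightarrow> level_at j \<omega> \<le> a"
  using x_le by (cases j) (simp_all only: ams_level_0 ams_level_Suc[OF k_in] running_at_Suc less_imp_le)

text \<open>
  As long as the algorithm runs, its level is at most \<open>a\<close>, so conditioning on exceeding it is
  always meaningful.
\<close>

lemma emeasure_above: "z \<le> a \<Longrightarrow> emeasure \<mu> {z<..} \<noteq> 0"
proof -
  assume z: "z \<le> a"
  interpret law: real_distribution \<mu> by (rule \<mu>)
  have "emeasure \<mu> {a<..} \<le> emeasure \<mu> {z<..}" by (rule emeasure_mono) (use z in auto)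
  then show ?thesis using above_a by auto
qed

text \<open>
  Whether iteration \<open>j\<close> is reached, and the cloud at that time, are functions of the initial sample
  and the uniforms of the iterations up to \<open>j\<close>; those of the next iteration are independent of
  them.
\<close>

lemma nn_integral_fresh_uniforms:
  assumes \<phi>: "\<phi> \<in> borel_measurable ((\<Pi>\<^sub>M i\<in>{1..n}. borel) \<Otimes>\<^sub>M (\<Pi>\<^sub>M l\<in>{1..k}. borel))"
  shows "(\<integral>\<^sup>+\<omega>. (if running_at j \<omega> then \<phi> (cloud_at j \<omega>, \<lambda>l\<in>{1..k}. U (Suc j) l \<omega>) else 0) \<partial>N)
    = (\<integral>\<^sup>+\<omega>. (if running_at j \<omega> then (\<integral>\<^sup>+v. \<phi> (cloud_at j \<omega>, v) \<partial>PiM {1..k} (\<lambda>_. unif)) else 0) \<partial>N)"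
proof -
  let ?V = "case_sum X0 (\<lambda>(j, l). U j l)" and ?h = "\<lambda>l. Inr (Suc j, l) :: nat + nat \<times> nat"
  define A :: "(nat + nat \<times> nat) set" where "A = {1..n} <+> ({1..j} \<times> {1..k})"
  let ?x0 = "\<lambda>p i. p (Inl i) :: real" and ?u = "\<lambda>p i l. p (Inr (i, l)) :: real"
  let ?past = "\<lambda>\<omega>. \<lambda>i\<in>A. ?V i \<omega>"
  define \<Phi> where "\<Phi> q = (if running \<mu> n k a (?x0 (fst q)) (?u (fst q)) j
    then \<phi> (cloud \<mu> n k (?x0 (fst q)) (?u (fst q)) j, snd q) else 0)" for q
  have x0: "(\<lambda>q. fst q (Inl i)) \<in> borel_measurable ((\<Pi>\<^sub>M i\<in>A. borel) \<Otimes>\<^sub>M (\<Pi>\<^sub>M l\<in>{1..k}. borel))"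
    if "i \<in> {1..n}" for i
    by (rule measurable_compose[OF measurable_fst measurable_component_singleton]) (use that in \<open>auto simp: A_def\<close>)
  have u: "(\<lambda>q. fst q (Inr (i, l))) \<in> borel_measurable ((\<Pi>\<^sub>M i\<in>A. borel) \<Otimes>\<^sub>M (\<Pi>\<^sub>M l\<in>{1..k}. borel))"
    if "i \<in> {1..j}" "l \<in> {1..k}" for i l
    by (rule measurable_compose[OF measurable_fst measurable_component_singleton]) (use that in \<open>auto simp: A_def\<close>)
  have \<Phi>_m: "\<Phi> \<in> borel_measurable ((\<Pi>\<^sub>M i\<in>A. borel) \<Otimes>\<^sub>M (\<Pi>\<^sub>M l\<in>{1..k}. borel))"
    unfolding \<Phi>_def
  proof (rule measurable_If)
    show "(\<lambda>q. \<phi> (cloud \<mu> n k (?x0 (fst q)) (?u (fst q)) j, snd q))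
      \<in> borel_measurable ((\<Pi>\<^sub>M i\<in>A. borel) \<Otimes>\<^sub>M (\<Pi>\<^sub>M l\<in>{1..k}. borel))"
      by (rule measurable_compose[OF measurable_Pair[OF measurable_cloud[OF \<mu> k_in x0 u] measurable_snd] \<phi>])
    show "{q \<in> space ((\<Pi>\<^sub>M i\<in>A. borel) \<Otimes>\<^sub>M (\<Pi>\<^sub>M l\<in>{1..k}. borel)). running \<mu> n k a (?x0 (fst q)) (?u (fst q)) j}
      \<in> sets ((\<Pi>\<^sub>M i\<in>A. borel) \<Otimes>\<^sub>M (\<Pi>\<^sub>M l\<in>{1..k}. borel))"
      by (rule sets_running[OF \<mu> k_in x0 u])
  qed simp
  have past: "?x0 (?past \<omega>) i = X0 i \<omega>" if "i \<in> {1..n}" for i \<omega>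
    using that by (auto simp: A_def)
  have past': "?u (?past \<omega>) i l = U i l \<omega>" if "i \<in> {1..j}" "l \<in> {1..k}" for i l \<omega>
    using that by (auto simp: A_def)
  have cl_past: "cloud \<mu> n k (?x0 (?past \<omega>)) (?u (?past \<omega>)) j = cloud_at j \<omega>" for \<omega>
    by (rule cloud_cong[OF k_in past past'])
  have rn_past: "running \<mu> n k a (?x0 (?past \<omega>)) (?u (?past \<omega>)) j = running_at j \<omega>" for \<omega>
    by (rule running_cong[OF k_in past past'])
  have \<Phi>_past: "\<Phi> (?past \<omega>, v) = (if running_at j \<omega> then \<phi> (cloud_at j \<omega>, v) else 0)" for \<omega> v
    unfolding \<Phi>_def fst_conv snd_conv cl_past rn_past ..
  have "(\<integral>\<^sup>+\<omega>. \<Phi> (?past \<omega>, \<lambda>l\<in>{1..k}. ?V (?h l) \<omega>) \<partial>N)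
    = (\<integral>\<^sup>+\<omega>. (\<integral>\<^sup>+v. \<Phi> (?past \<omega>, v) \<partial>PiM {1..k} (\<lambda>_. unif)) \<partial>N)"
    by (rule nn_integral_indep_block[OF indep _ _ _ _ _ _ \<Phi>_m])
      (use k law_U in \<open>auto simp: A_def inj_on_def\<close>)
  also have "\<dots> = (\<integral>\<^sup>+\<omega>. (if running_at j \<omega> then (\<integral>\<^sup>+v. \<phi> (cloud_at j \<omega>, v) \<partial>PiM {1..k} (\<lambda>_. unif)) else 0) \<partial>N)"
    unfolding \<Phi>_past by (intro nn_integral_cong) simp
  finally show ?thesis unfolding \<Phi>_past by (simp only: sum.case prod.case)
qed

lemma cloud_at_Suc: "cloud_at (Suc j) \<omega> = resample \<mu> n k (cloud_at j \<omega>) (\<lambda>l\<in>{1..k}. U (Suc j) l \<omega>)"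
  unfolding cloud_Suc[OF k_in] by (rule resample_cong) (simp_all only: restrict_apply if_True k_in)

text \<open>
  The absence of memory: on the event that iteration \<open>j\<close> is reached, the cloud may be replaced by a
  fresh i.i.d. sample above the current level. In the induction step the fresh uniforms are
  integrated out, the induction hypothesis replaces the old cloud by an i.i.d. sample, the one-step
  result is applied to that sample, and the induction hypothesis is applied backwards to return to
  the actual cloud.
\<close>

lemma nn_integral_cloud_given_level:
  assumes H: "H \<in> borel_measurable (borel \<Otimes>\<^sub>M (\<Pi>\<^sub>M i\<in>{1..n}. borel))"
  shows "(\<integral>\<^sup>+\<omega>. (if running_at j \<omega> then H (level_at j \<omega>, cloud_at j \<omega>) else 0) \<partial>N)
    = (\<integral>\<^sup>+\<omega>. (if running_at j \<omega> then (\<integral>\<^sup>+v. H (level_at j \<omega>, sample_above \<mu> {1..n} (level_at j \<omega>) v) \<partial>PiM {1..n} (\<lambda>_. unif)) else 0) \<partial>N)"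
  using H
proof (induction j arbitrary: H)
  case 0
  have x: "emeasure \<mu> {x<..} \<noteq> 0" by (rule emeasure_above[OF x_le])
  have joint: "distr N (\<Pi>\<^sub>M i\<in>{1..n}. borel) (cloud_at 0) = PiM {1..n} (\<lambda>_. cond_law \<mu> x)"
  proof -
    have "distr N (\<Pi>\<^sub>M i\<in>{1..n}. borel) (\<lambda>\<omega>. \<lambda>i\<in>{1..n}. case_sum X0 (\<lambda>(j, l). U j l) (Inl i) \<omega>)
      = (\<Pi>\<^sub>M i\<in>{1..n}. distr N borel (case_sum X0 (\<lambda>(j, l). U j l) (Inl i)))"
      by (rule distr_indep_vars_reindex[OF indep]) (use k in \<open>auto simp: inj_on_def\<close>)
    moreover have "(\<Pi>\<^sub>M i\<in>{1..n}. distr N borel (X0 i)) = PiM {1..n} (\<lambda>_. cond_law \<mu> x)"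
      by (rule PiM_cong) (auto simp: law_X0)
    ultimately show ?thesis by (simp only: cloud_0 sum.case)
  qed
  have Hx: "(\<lambda>y. H (x, y)) \<in> borel_measurable (\<Pi>\<^sub>M i\<in>{1..n}. borel)"
    by (rule measurable_compose[OF measurable_Pair1' 0]) simp
  have "(\<integral>\<^sup>+\<omega>. H (x, cloud_at 0 \<omega>) \<partial>N) = (\<integral>\<^sup>+y. H (x, y) \<partial>PiM {1..n} (\<lambda>_. cond_law \<mu> x))"
    unfolding joint[symmetric]
    by (rule nn_integral_distr[OF measurable_cloud_at, symmetric]) (unfold measurable_distr_eq1, rule Hx)
  also have "\<dots> = (\<integral>\<^sup>+v. H (x, sample_above \<mu> {1..n} x v) \<partial>PiM {1..n} (\<lambda>_. unif))"
    by (rule nn_integral_PiM_cond_law[OF \<mu> x finite_atLeastAtMost Hx])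
  finally show ?case
    by (simp add: running_def ams_level_0 emeasure_space_1)
next
  case (Suc j)
  let ?os = "order_stat n k"
  let ?U = "PiM {1..n} (\<lambda>_. unif)"
  define G where "G y = (\<integral>\<^sup>+v. (if ?os y < a then H (?os y, resample \<mu> n k y v) else 0) \<partial>PiM {1..k} (\<lambda>_. unif))" for y
  \<comment> \<open>\<open>G\<close> continues from the cloud \<open>y\<close> with the actual resampling step, \<open>G'\<close> with a fresh sample
    above its order statistic. Both include the test of this order statistic against \<open>a\<close>.\<close>
  define G' where "G' y = (\<integral>\<^sup>+v. (if ?os y < a then H (?os y, sample_above \<mu> {1..n} (?os y) v) else 0) \<partial>?U)" for y
  have comp: "(\<lambda>p. snd p l) \<in> borel_measurable (\<Omega> \<Otimes>\<^sub>M (\<Pi>\<^sub>M i\<in>S. borel))" if "l \<in> S"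
    for \<Omega> :: "(nat \<Rightarrow> real) measure" and S and l :: nat
    by (rule measurable_compose[OF measurable_snd measurable_component_singleton[OF that]])
  have os: "(\<lambda>p. ?os (fst p)) \<in> borel_measurable ((\<Pi>\<^sub>M i\<in>{1..n}. borel) \<Otimes>\<^sub>M \<Omega>)" for \<Omega> :: "(nat \<Rightarrow> real) measure"
    by (rule measurable_compose[OF measurable_fst measurable_order_stat[OF k_in]])
  have os_less: "{p \<in> space ((\<Pi>\<^sub>M i\<in>{1..n}. borel) \<Otimes>\<^sub>M \<Omega>). ?os (fst p) < a} \<in> sets ((\<Pi>\<^sub>M i\<in>{1..n}. borel) \<Otimes>\<^sub>M \<Omega>)"
    for \<Omega> :: "(nat \<Rightarrow> real) measure"
    by (rule borel_measurable_less[OF os]) simp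
  have Ha: "(\<lambda>p. if fst p < a then H p else 0) \<in> borel_measurable (borel \<Otimes>\<^sub>M (\<Pi>\<^sub>M i\<in>{1..n}. borel))"
    by (rule measurable_If[OF Suc.prems]) simp_all
  have kernel: "(\<lambda>p. if ?os (fst p) < a then H (?os (fst p), resample \<mu> n k (fst p) (snd p)) else 0)
    \<in> borel_measurable ((\<Pi>\<^sub>M i\<in>{1..n}. borel) \<Otimes>\<^sub>M (\<Pi>\<^sub>M l\<in>{1..k}. borel))"
    by (rule measurable_If[OF _ measurable_const os_less],
        rule measurable_compose[OF measurable_Pair[OF os measurable_resample[OF \<mu> k_in measurable_fst comp]] Suc.prems])
      simp_all
  have kernel': "(\<lambda>p. if ?os (fst p) < a then H (?os (fst p), sample_above \<mu> {1..n} (?os (fst p)) (snd p)) else 0)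
    \<in> borel_measurable ((\<Pi>\<^sub>M i\<in>{1..n}. borel) \<Otimes>\<^sub>M (\<Pi>\<^sub>M l\<in>{1..n}. borel))"
    by (rule measurable_If[OF _ measurable_const os_less],
        rule measurable_compose[OF measurable_Pair[OF os measurable_sample_above[OF \<mu> os comp]] Suc.prems])
      simp_all
  have Gm: "G \<in> borel_measurable (\<Pi>\<^sub>M i\<in>{1..n}. borel)"
    unfolding G_def by (rule borel_measurable_nn_integral_PiM_unif) (unfold case_prod_unfold, rule kernel)
  have Gm': "G' \<in> borel_measurable (\<Pi>\<^sub>M i\<in>{1..n}. borel)"
    unfolding G'_def by (rule borel_measurable_nn_integral_PiM_unif) (unfold case_prod_unfold, rule kernel')
  have exchange: "(\<integral>\<^sup>+v. G (sample_above \<mu> {1..n} z v) \<partial>?U) = (\<integral>\<^sup>+v. G' (sample_above \<mu> {1..n} z v) \<partial>?U)"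
    if "z \<le> a" for z
  proof -
    have z: "emeasure \<mu> {z<..} \<noteq> 0" by (rule emeasure_above[OF that])
    show ?thesis
      unfolding nn_integral_PiM_cond_law[OF \<mu> z finite_atLeastAtMost Gm, symmetric]
        nn_integral_PiM_cond_law[OF \<mu> z finite_atLeastAtMost Gm', symmetric]
      using nn_integral_resample_above[OF \<mu> atomless k z Ha]
      by (simp only: G_def[abs_def] G'_def[abs_def] fst_conv)
  qed
  have "(\<integral>\<^sup>+\<omega>. (if running_at (Suc j) \<omega> then H (level_at (Suc j) \<omega>, cloud_at (Suc j) \<omega>) else 0) \<partial>N)
    = (\<integral>\<^sup>+\<omega>. (if running_at j \<omega> then G (cloud_at j \<omega>) else 0) \<partial>N)"
    using nn_integral_fresh_uniforms[OF kernel, of j]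
    unfolding fst_conv snd_conv G_def
    by (simp only: running_at_Suc ams_level_Suc[OF k_in] cloud_at_Suc if_if_eq_conj)
  also have "\<dots> = (\<integral>\<^sup>+\<omega>. (if running_at j \<omega> then (\<integral>\<^sup>+v. G (sample_above \<mu> {1..n} (level_at j \<omega>) v) \<partial>?U) else 0) \<partial>N)"
    using Suc.IH[OF measurable_compose[OF measurable_snd Gm]] by (simp only: snd_conv)
  also have "\<dots> = (\<integral>\<^sup>+\<omega>. (if running_at j \<omega> then (\<integral>\<^sup>+v. G' (sample_above \<mu> {1..n} (level_at j \<omega>) v) \<partial>?U) else 0) \<partial>N)"
    by (intro nn_integral_cong if_cong refl exchange level_at_le)
  also have "\<dots> = (\<integral>\<^sup>+\<omega>. (if running_at j \<omega> then G' (cloud_at j \<omega>) else 0) \<partial>N)"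
    using Suc.IH[OF measurable_compose[OF measurable_snd Gm']] by (simp only: snd_conv)
  also have "\<dots> = (\<integral>\<^sup>+\<omega>. (if running_at (Suc j) \<omega>
      then (\<integral>\<^sup>+v. H (level_at (Suc j) \<omega>, sample_above \<mu> {1..n} (level_at (Suc j) \<omega>) v) \<partial>?U) else 0) \<partial>N)"
    unfolding G'_def running_at_Suc ams_level_Suc[OF k_in] by (intro nn_integral_cong) simp
  finally show ?case .
qed

end

section \<open>Counting survivors and unbiasedness\<close>

text \<open>
  The number of particles at or above the target level, as an extended nonnegative real.
\<close>

definition survivors :: "nat \<Rightarrow> real \<Rightarrow> (nat \<Rightarrow> real) \<Rightarrow> ennreal" where
  "survivors n a y = (\<Sum>i\<in>{1..n}. indicator {a..} (y i))"

text \<open>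
  The probability of reaching \<open>a\<close> from \<open>z\<close>, written with a uniform variable so that it is a
  measurable function of \<open>z\<close>; see \<open>hit_prob_eq\<close>.
\<close>

definition hit_prob :: "real measure \<Rightarrow> real \<Rightarrow> real \<Rightarrow> ennreal" where
  "hit_prob \<mu> a z = (\<integral>\<^sup>+t. indicator {a..} (quantile_above \<mu> z t) \<partial>unif)"

lemma survivors_eq_card: "survivors n a y = of_nat (card {i \<in> {1..n}. a \<le> y i})"
proof -
  have "survivors n a y = (\<Sum>i\<in>{1..n}. if a \<le> y i then 1 else 0)"
    unfolding survivors_def by (rule sum.cong) (simp_all add: indicator_def)
  also have "\<dots> = of_nat (card {i \<in> {1..n}. a \<le> y i})"
    by (subst sum.inter_filter[symmetric]) simp_all
  finally show ?thesis .
qed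

lemma measurable_survivors: "survivors n a \<in> borel_measurable (\<Pi>\<^sub>M i\<in>{1..n}. borel)"
  unfolding survivors_def
  by (intro borel_measurable_sum measurable_compose[OF measurable_component_singleton borel_measurable_indicator])
    simp_all

lemma measurable_hit_prob:
  assumes \<mu>: "real_distribution \<mu>"
  shows "hit_prob \<mu> a \<in> borel_measurable borel"
proof -
  interpret prob_space unif by (rule prob_space_unif)
  have "sets (borel \<Otimes>\<^sub>M unif) = sets (borel \<Otimes>\<^sub>M (borel :: real measure) :: (real \<times> real) measure)"
    by (rule sets_pair_measure_cong) simp_all
  note cong = measurable_cong_sets[OF this refl]
  show ?thesis
    unfolding hit_prob_def
    by (rule borel_measurable_nn_integral)
      (unfold case_prod_unfold cong, intro measurable_compose[OF measurable_quantile_above[OF \<mu>] borel_measurable_indicator]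
        measurable_fst measurable_snd; simp)
qed

lemma hit_prob_eq:
  assumes \<mu>: "real_distribution \<mu>" and z: "emeasure \<mu> {z<..} \<noteq> 0"
  shows "hit_prob \<mu> a z = emeasure (cond_law \<mu> z) {a..}"
proof -
  have [measurable]: "quantile_above \<mu> z \<in> borel_measurable borel"
    by (rule measurable_quantile_above[OF \<mu>]) auto
  have "emeasure (cond_law \<mu> z) {a..} = (\<integral>\<^sup>+t. indicator {a..} t \<partial>distr unif borel (quantile_above \<mu> z))"
    unfolding distr_unif_inverse_cdf[OF real_distribution_cond_law[OF \<mu> z]]
    by (rule nn_integral_indicator[symmetric]) (simp add: real_distribution.events_eq_borel[OF \<mu>])
  also have "\<dots> = hit_prob \<mu> a z"
    unfolding hit_prob_def by (subst nn_integral_distr) auto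
  finally show ?thesis by simp
qed

lemma hit_prob_le_1: "hit_prob \<mu> a z \<le> 1"
proof -
  interpret prob_space unif by (rule prob_space_unif)
  have "hit_prob \<mu> a z \<le> (\<integral>\<^sup>+t. 1 \<partial>unif)"
    unfolding hit_prob_def by (rule nn_integral_mono) (simp add: indicator_def)
  then show ?thesis by (simp only: nn_integral_const emeasure_space_1 mult_1_left)
qed

lemma nn_integral_quantile_component:
  assumes \<mu>: "real_distribution \<mu>" and i: "i \<in> S"
  shows "(\<integral>\<^sup>+v. indicator {a..} (quantile_above \<mu> z (v i)) \<partial>PiM S (\<lambda>_. unif)) = hit_prob \<mu> a z"
proof -
  have [measurable]: "quantile_above \<mu> z \<in> borel_measurable borel"
    by (rule measurable_quantile_above[OF \<mu>]) auto
  have "hit_prob \<mu> a z = (\<integral>\<^sup>+t. indicator {a..} (quantile_above \<mu> z t) \<partial>distr (PiM S (\<lambda>_. unif)) unif (\<lambda>v. v i))"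
    unfolding hit_prob_def using distr_PiM_component[of S "\<lambda>_. unif" i] prob_space_unif i by simp
  also have "\<dots> = (\<integral>\<^sup>+v. indicator {a..} (quantile_above \<mu> z (v i)) \<partial>PiM S (\<lambda>_. unif))"
    by (rule nn_integral_distr) (use i in auto)
  finally show ?thesis by simp
qed

lemma measurable_quantile_component:
  assumes \<mu>: "real_distribution \<mu>" and i: "i \<in> S"
  shows "(\<lambda>v. indicator {a..} (quantile_above \<mu> z (v i)) :: ennreal) \<in> borel_measurable (PiM S (\<lambda>_. unif))"
  unfolding measurable_cong_sets[OF sets_PiM_unif refl]
  by (intro measurable_compose[OF measurable_quantile_above[OF \<mu>] borel_measurable_indicator]
      measurable_component_singleton i measurable_const) simp_all

lemma nn_integral_survivors_sample_above:
  assumes \<mu>: "real_distribution \<mu>"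
  shows "(\<integral>\<^sup>+v. survivors n a (sample_above \<mu> {1..n} z v) \<partial>PiM {1..n} (\<lambda>_. unif)) = of_nat n * hit_prob \<mu> a z"
proof -
  have "(\<integral>\<^sup>+v. survivors n a (sample_above \<mu> {1..n} z v) \<partial>PiM {1..n} (\<lambda>_. unif))
    = (\<integral>\<^sup>+v. (\<Sum>i\<in>{1..n}. indicator {a..} (quantile_above \<mu> z (v i))) \<partial>PiM {1..n} (\<lambda>_. unif))"
    unfolding survivors_def sample_above_def by (intro nn_integral_cong sum.cong refl) (simp only: restrict_apply if_True)
  also have "\<dots> = (\<Sum>i\<in>{1..n}. \<integral>\<^sup>+v. indicator {a..} (quantile_above \<mu> z (v i)) \<partial>PiM {1..n} (\<lambda>_. unif))"
    by (rule nn_integral_sum) (rule measurable_quantile_component[OF \<mu>])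
  also have "\<dots> = (\<Sum>i\<in>{1..n}. hit_prob \<mu> a z)"
    by (intro sum.cong refl nn_integral_quantile_component[OF \<mu>])
  finally show ?thesis by simp
qed

text \<open>
  All \<open>k\<close> resampled particles are at or below the level, hence below \<open>a\<close>: no survivor is lost, and
  each new particle is one with the hitting probability from the level.
\<close>

lemma nn_integral_survivors_resample:
  assumes \<mu>: "real_distribution \<mu>" and k: "k \<in> {1..n}" and less: "order_stat n k y < a"
  shows "(\<integral>\<^sup>+v. survivors n a (resample \<mu> n k y v) \<partial>PiM {1..k} (\<lambda>_. unif))
    = survivors n a y + of_nat k * hit_prob \<mu> a (order_stat n k y)"
proof -
  let ?\<sigma> = "sorting_perm n y" and ?w = "order_stat n k y"
  let ?U = "PiM {1..k} (\<lambda>_. unif)"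
  interpret U: prob_space ?U by (rule prob_space_PiM_unif)
  have \<sigma>: "?\<sigma> permutes {1..n}" by (rule sorting_perm_permutes)
  define B where "B = ?\<sigma> ` {1..k}"
  have B: "B \<subseteq> {1..n}"
    unfolding B_def using permutes_image[OF \<sigma>] k by (metis atLeastAtMost_iff atLeastatMost_subset_iff image_mono le_refl)
  have cardB: "card B = k"
    unfolding B_def using permutes_inj_on[OF \<sigma>] by (subst card_image) auto
  have B_iff: "inv ?\<sigma> i \<in> {1..k} \<longleftrightarrow> i \<in> B" for i
    unfolding B_def using permutes_inverses[OF \<sigma>] by (metis image_iff)
  have low: "y i < a" if "i \<in> B" for i
  proof -
    obtain l where l: "l \<in> {1..k}" "i = ?\<sigma> l" using \<open>i \<in> B\<close> by (auto simp: B_def)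
    then have "l \<in> {1..n}" "l \<le> k" using k by auto
    then have "y (?\<sigma> l) \<le> y (?\<sigma> k)"
      using mono_on_sorting_perm[of n y] k by (auto simp: monotone_on_def)
    then show ?thesis using l less by (simp add: order_stat_def)
  qed
  have split: "(\<Sum>i\<in>{1..n}. f i) = (\<Sum>i\<in>B. f i) + (\<Sum>i\<in>{1..n} - B. f i)" for f :: "nat \<Rightarrow> ennreal"
    using sum.subset_diff[OF B, of f] by (simp add: add.commute)
  have "survivors n a (resample \<mu> n k y v) =
    (\<Sum>i\<in>B. indicator {a..} (quantile_above \<mu> ?w (v (inv ?\<sigma> i)))) + (\<Sum>i\<in>{1..n} - B. indicator {a..} (y i))" for v
    unfolding survivors_def split
    by (intro arg_cong2[where f="(+)"] sum.cong refl)
      (use B in \<open>auto simp only: resample_def Let_def restrict_apply B_iff if_True if_False Diff_iff subset_iff\<close>)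
  then have "(\<integral>\<^sup>+v. survivors n a (resample \<mu> n k y v) \<partial>?U)
    = (\<integral>\<^sup>+v. (\<Sum>i\<in>B. indicator {a..} (quantile_above \<mu> ?w (v (inv ?\<sigma> i))))
        + (\<Sum>i\<in>{1..n} - B. indicator {a..} (y i)) \<partial>?U)"
    by (simp only:)
  also have "\<dots> = (\<integral>\<^sup>+v. (\<Sum>i\<in>B. indicator {a..} (quantile_above \<mu> ?w (v (inv ?\<sigma> i)))) \<partial>?U)
      + (\<Sum>i\<in>{1..n} - B. indicator {a..} (y i))"
    by (subst nn_integral_add)
      (auto simp only: nn_integral_const U.emeasure_space_1 mult_1_right B_iff space_borel UNIV_I
        intro!: borel_measurable_sum measurable_quantile_component[OF \<mu>] measurable_const)
  also have "(\<integral>\<^sup>+v. (\<Sum>i\<in>B. indicator {a..} (quantile_above \<mu> ?w (v (inv ?\<sigma> i)))) \<partial>?U)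
      = (\<Sum>i\<in>B. \<integral>\<^sup>+v. indicator {a..} (quantile_above \<mu> ?w (v (inv ?\<sigma> i))) \<partial>?U)"
    by (rule nn_integral_sum) (rule measurable_quantile_component[OF \<mu>], simp only: B_iff)
  also have "\<dots> = (\<Sum>i\<in>B. hit_prob \<mu> a ?w)"
    by (intro sum.cong refl nn_integral_quantile_component[OF \<mu>]) (simp only: B_iff)
  also have "\<dots> = of_nat k * hit_prob \<mu> a ?w" by (simp add: cardB)
  also have "(\<Sum>i\<in>{1..n} - B. indicator {a..} (y i)) = survivors n a y"
  proof -
    have "(\<Sum>i\<in>B. indicator {a..} (y i)) = (0 :: ennreal)"
      by (rule sum.neutral) (use low in \<open>auto simp: indicator_def not_le\<close>)
    then show ?thesis unfolding survivors_def split by simp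
  qed
  finally show ?thesis by (simp only: add.commute)
qed

context ams_run
begin

text \<open>
  This and the next definition are the quantities \<open>b\<^sub>j\<close> and \<open>c\<^sub>j\<close> of the introduction.
\<close>

definition alive_value :: "nat \<Rightarrow> ennreal" where
  "alive_value j = (\<integral>\<^sup>+\<omega>. (if running_at j \<omega> then hit_prob \<mu> a (level_at j \<omega>) else 0) \<partial>N)"

definition stopped_survivors :: "nat \<Rightarrow> ennreal" where
  "stopped_survivors j = (\<integral>\<^sup>+\<omega>. (if running_at j \<omega> \<and> \<not> running_at (Suc j) \<omega> then survivors n a (cloud_at j \<omega>) else 0) \<partial>N)"

lemma alive_value_le_1: "alive_value j \<le> 1"
proof -
  have "alive_value j \<le> (\<integral>\<^sup>+\<omega>. 1 \<partial>N)"
    unfolding alive_value_def by (rule nn_integral_mono) (simp add: hit_prob_le_1)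
  then show ?thesis by (simp add: emeasure_space_1)
qed

lemma measurable_survivors_at: "(\<lambda>\<omega>. survivors n a (cloud_at j \<omega>)) \<in> borel_measurable N"
  by (rule measurable_compose[OF measurable_cloud_at measurable_survivors])

lemma sets_stopped: "{\<omega> \<in> space N. running_at j \<omega> \<and> \<not> running_at (Suc j) \<omega>} \<in> sets N"
proof -
  have "{\<omega> \<in> space N. running_at j \<omega> \<and> \<not> running_at (Suc j) \<omega>} = {\<omega> \<in> space N. running_at j \<omega>} - {\<omega> \<in> space N. running_at (Suc j) \<omega>}"
    by blast
  then show ?thesis by (simp only: sets.Diff[OF sets_running_at sets_running_at])
qed

text \<open>
  By the absence of memory each of the \<open>n\<close> particles survives with the hitting probability from the
  current level.
\<close>

lemma nn_integral_survivors_at: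
  "(\<integral>\<^sup>+\<omega>. (if running_at j \<omega> then survivors n a (cloud_at j \<omega>) else 0) \<partial>N) = of_nat n * alive_value j"
proof -
  have hit: "(\<lambda>\<omega>. if running_at j \<omega> then hit_prob \<mu> a (level_at j \<omega>) else 0) \<in> borel_measurable N"
    by (rule measurable_If[OF measurable_compose[OF measurable_level_at measurable_hit_prob[OF \<mu>]] measurable_const sets_running_at]) simp
  have "(\<integral>\<^sup>+\<omega>. (if running_at j \<omega> then survivors n a (cloud_at j \<omega>) else 0) \<partial>N)
    = (\<integral>\<^sup>+\<omega>. of_nat n * (if running_at j \<omega> then hit_prob \<mu> a (level_at j \<omega>) else 0) \<partial>N)"
    using nn_integral_cloud_given_level[OF measurable_compose[OF measurable_snd measurable_survivors], of j]
    unfolding snd_conv nn_integral_survivors_sample_above[OF \<mu>]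
    by (simp only: if_distrib[of "(*) (of_nat n)"] mult_zero_right)
  also have "\<dots> = of_nat n * alive_value j"
    unfolding alive_value_def by (rule nn_integral_cmult[OF hit])
  finally show ?thesis .
qed

lemma nn_integral_survivors_step:
  "(\<integral>\<^sup>+\<omega>. (if running_at (Suc j) \<omega> then survivors n a (cloud_at (Suc j) \<omega>) else 0) \<partial>N)
    = (\<integral>\<^sup>+\<omega>. (if running_at (Suc j) \<omega> then survivors n a (cloud_at j \<omega>) else 0) \<partial>N) + of_nat k * alive_value (Suc j)"
proof -
  let ?os = "order_stat n k"
  have comp: "(\<lambda>p. snd p l) \<in> borel_measurable (\<Omega> \<Otimes>\<^sub>M (\<Pi>\<^sub>M i\<in>S. borel))" if "l \<in> S"
    for \<Omega> :: "(nat \<Rightarrow> real) measure" and S and l :: nat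
    by (rule measurable_compose[OF measurable_snd measurable_component_singleton[OF that]])
  have os_less: "{p \<in> space ((\<Pi>\<^sub>M i\<in>{1..n}. borel) \<Otimes>\<^sub>M (\<Pi>\<^sub>M l\<in>{1..k}. (borel :: real measure))). ?os (fst p) < a}
    \<in> sets ((\<Pi>\<^sub>M i\<in>{1..n}. borel) \<Otimes>\<^sub>M (\<Pi>\<^sub>M l\<in>{1..k}. (borel :: real measure)))"
    by (rule borel_measurable_less[OF measurable_compose[OF measurable_fst measurable_order_stat[OF k_in]]]) simp
  have kernel: "(\<lambda>p. if ?os (fst p) < a then survivors n a (resample \<mu> n k (fst p) (snd p)) else 0)
    \<in> borel_measurable ((\<Pi>\<^sub>M i\<in>{1..n}. borel) \<Otimes>\<^sub>M (\<Pi>\<^sub>M l\<in>{1..k}. borel))"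
    by (rule measurable_If[OF _ measurable_const os_less],
        rule measurable_compose[OF measurable_resample[OF \<mu> k_in measurable_fst comp] measurable_survivors])
      simp_all
  have measurable_on_running: "(\<lambda>\<omega>. if running_at (Suc j) \<omega> then f \<omega> else 0) \<in> borel_measurable N"
    if "f \<in> borel_measurable N" for f :: "'b \<Rightarrow> ennreal"
    by (rule measurable_If[OF that measurable_const sets_running_at]) simp
  have hit: "(\<lambda>\<omega>. if running_at (Suc j) \<omega> then hit_prob \<mu> a (level_at (Suc j) \<omega>) else 0) \<in> borel_measurable N"
    by (rule measurable_on_running[OF measurable_compose[OF measurable_level_at measurable_hit_prob[OF \<mu>]]])
  have "(\<integral>\<^sup>+\<omega>. (if running_at (Suc j) \<omega> then survivors n a (cloud_at (Suc j) \<omega>) else 0) \<partial>N)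
    = (\<integral>\<^sup>+\<omega>. (if running_at j \<omega> then (\<integral>\<^sup>+v. (if ?os (cloud_at j \<omega>) < a then survivors n a (resample \<mu> n k (cloud_at j \<omega>) v) else 0)
        \<partial>PiM {1..k} (\<lambda>_. unif)) else 0) \<partial>N)"
    using nn_integral_fresh_uniforms[OF kernel, of j]
    unfolding fst_conv snd_conv by (simp only: running_at_Suc cloud_at_Suc if_if_eq_conj)
  also have "\<dots> = (\<integral>\<^sup>+\<omega>. (if running_at (Suc j) \<omega> then survivors n a (cloud_at j \<omega>) else 0)
      + of_nat k * (if running_at (Suc j) \<omega> then hit_prob \<mu> a (level_at (Suc j) \<omega>) else 0) \<partial>N)"
  proof (rule nn_integral_cong)
    fix \<omega>
    show "(if running_at j \<omega> then (\<integral>\<^sup>+v. (if ?os (cloud_at j \<omega>) < a then survivors n a (resample \<mu> n k (cloud_at j \<omega>) v) else 0)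
        \<partial>PiM {1..k} (\<lambda>_. unif)) else 0) = (if running_at (Suc j) \<omega> then survivors n a (cloud_at j \<omega>) else 0)
      + of_nat k * (if running_at (Suc j) \<omega> then hit_prob \<mu> a (level_at (Suc j) \<omega>) else 0)"
      by (cases "running_at j \<omega>"; cases "?os (cloud_at j \<omega>) < a")
        (simp_all only: running_at_Suc ams_level_Suc[OF k_in] nn_integral_survivors_resample[OF \<mu> k_in] if_True if_False simp_thms
          nn_integral_const mult_zero_left mult_zero_right add_0_right)
  qed
  also have "\<dots> = (\<integral>\<^sup>+\<omega>. (if running_at (Suc j) \<omega> then survivors n a (cloud_at j \<omega>) else 0) \<partial>N)
      + (\<integral>\<^sup>+\<omega>. of_nat k * (if running_at (Suc j) \<omega> then hit_prob \<mu> a (level_at (Suc j) \<omega>) else 0) \<partial>N)"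
    by (intro nn_integral_add measurable_on_running measurable_survivors_at borel_measurable_times_ennreal hit measurable_const) simp
  also have "(\<integral>\<^sup>+\<omega>. of_nat k * (if running_at (Suc j) \<omega> then hit_prob \<mu> a (level_at (Suc j) \<omega>) else 0) \<partial>N)
      = of_nat k * alive_value (Suc j)"
    unfolding alive_value_def by (rule nn_integral_cmult[OF hit])
  finally show ?thesis .
qed

text \<open>
  The survivors present when iteration \<open>j\<close> is reached are split according to whether the algorithm
  stops. On the event that it goes on, their expected number \<open>e\<close> is obtained by counting after the
  resampling step instead: there are \<open>n b\<close> survivors then, of which \<open>k b\<close> are new, where \<open>b\<close> belongs
  to the next iteration. Hence \<open>e = (n - k) b\<close>.
\<close>

lemma alive_value_Suc:
  "of_nat n * alive_value j = stopped_survivors j + of_nat (n - k) * alive_value (Suc j)"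
proof -
  let ?e = "\<integral>\<^sup>+\<omega>. (if running_at (Suc j) \<omega> then survivors n a (cloud_at j \<omega>) else 0) \<partial>N"
  have fin: "of_nat k * alive_value (Suc j) \<noteq> top"
    using alive_value_le_1[of "Suc j"] by (auto simp: ennreal_mult_eq_top_iff top_unique)
  have "of_nat n * alive_value (Suc j) = of_nat (n - k) * alive_value (Suc j) + of_nat k * alive_value (Suc j)"
  proof -
    have "of_nat n = (of_nat (n - k + k) :: ennreal)" using k by simp
    then show ?thesis by (simp only: of_nat_add distrib_right)
  qed
  with nn_integral_survivors_step[of j, unfolded nn_integral_survivors_at]
  have "of_nat k * alive_value (Suc j) + ?e = of_nat k * alive_value (Suc j) + of_nat (n - k) * alive_value (Suc j)"
    by (simp only: add.commute)
  then have e: "?e = of_nat (n - k) * alive_value (Suc j)"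
    using fin by (simp only: ennreal_add_left_cancel infinity_ennreal_def) blast
  have meas: "(\<lambda>\<omega>. if running_at (Suc j) \<omega> then survivors n a (cloud_at j \<omega>) else 0) \<in> borel_measurable N"
    by (rule measurable_If[OF measurable_survivors_at measurable_const sets_running_at]) simp
  have meas': "(\<lambda>\<omega>. if running_at j \<omega> \<and> \<not> running_at (Suc j) \<omega> then survivors n a (cloud_at j \<omega>) else 0) \<in> borel_measurable N"
    by (rule measurable_If[OF measurable_survivors_at measurable_const sets_stopped]) simp
  have "of_nat n * alive_value j = (\<integral>\<^sup>+\<omega>. (if running_at j \<omega> \<and> \<not> running_at (Suc j) \<omega> then survivors n a (cloud_at j \<omega>) else 0)
      + (if running_at (Suc j) \<omega> then survivors n a (cloud_at j \<omega>) else 0) \<partial>N)"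
    unfolding nn_integral_survivors_at[symmetric]
    by (rule nn_integral_cong) (simp add: running_at_Suc)
  also have "\<dots> = stopped_survivors j + ?e"
    unfolding stopped_survivors_def by (rule nn_integral_add[OF meas' meas])
  finally show ?thesis unfolding e .
qed

definition keep_ratio :: real where "keep_ratio = 1 - real k / real n"

lemma keep_ratio_bounds: "0 < keep_ratio" "keep_ratio < 1" using k by (auto simp: keep_ratio_def)

lemma alive_value_0: "alive_value 0 = hit_prob \<mu> a x"
  by (simp add: alive_value_def running_def ams_level_0 emeasure_space_1)

text \<open>
  The telescoping sum, in additive form because subtraction of extended nonnegative reals is
  truncated.
\<close>

lemma sum_stopped_survivors:
  "(\<Sum>j<m. ennreal (keep_ratio ^ j / n) * stopped_survivors j) + ennreal (keep_ratio ^ m) * alive_value m = hit_prob \<mu> a x"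
proof (induction m)
  case 0
  show ?case by (simp add: alive_value_0)
next
  case (Suc m)
  have n: "0 < real n" using k by simp
  have "ennreal (keep_ratio ^ m) * alive_value m = ennreal (keep_ratio ^ m / n) * (of_nat n * alive_value m)"
  proof -
    have "ennreal (keep_ratio ^ m / n) * of_nat n = ennreal (keep_ratio ^ m)"
      using n keep_ratio_bounds by (simp add: ennreal_of_nat_eq_real_of_nat ennreal_mult''[symmetric])
    then show ?thesis by (simp only: mult.assoc[symmetric])
  qed
  also have "\<dots> = ennreal (keep_ratio ^ m / n) * stopped_survivors m + ennreal (keep_ratio ^ Suc m) * alive_value (Suc m)"
  proof -
    have "keep_ratio ^ m / n * real (n - k) = keep_ratio ^ Suc m"
      using n k by (simp add: keep_ratio_def field_simps of_nat_diff)
    then have "ennreal (keep_ratio ^ m / n) * of_nat (n - k) = ennreal (keep_ratio ^ Suc m)"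
      using keep_ratio_bounds by (simp add: ennreal_of_nat_eq_real_of_nat ennreal_mult''[symmetric])
    then show ?thesis by (simp only: alive_value_Suc distrib_left mult.assoc[symmetric])
  qed
  finally have step: "ennreal (keep_ratio ^ m) * alive_value m
    = ennreal (keep_ratio ^ m / n) * stopped_survivors m + ennreal (keep_ratio ^ Suc m) * alive_value (Suc m)" .
  show ?case
    unfolding sum.lessThan_Suc Suc.IH[symmetric] step by (simp only: add.assoc)
qed

lemma suminf_stopped_survivors: "(\<Sum>j. ennreal (keep_ratio ^ j / n) * stopped_survivors j) = hit_prob \<mu> a x"
proof -
  let ?s = "\<lambda>m. \<Sum>j<m. ennreal (keep_ratio ^ j / n) * stopped_survivors j"
  have "(\<lambda>m. ennreal (keep_ratio ^ m)) \<longlonglongrightarrow> ennreal 0"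
    using keep_ratio_bounds by (intro tendsto_ennrealI LIMSEQ_power_zero) simp
  then have lim: "(\<lambda>m. ennreal (keep_ratio ^ m)) \<longlonglongrightarrow> 0" by simp
  have "(\<lambda>m. ennreal (keep_ratio ^ m) * alive_value m) \<longlonglongrightarrow> 0"
  proof (rule tendsto_sandwich[OF _ _ tendsto_const lim])
    have "ennreal (keep_ratio ^ m) * alive_value m \<le> ennreal (keep_ratio ^ m)" for m
      using mult_left_mono[OF alive_value_le_1[of m], of "ennreal (keep_ratio ^ m)"] by simp
    then show "\<forall>\<^sub>F m in sequentially. ennreal (keep_ratio ^ m) * alive_value m \<le> ennreal (keep_ratio ^ m)"
      by (intro always_eventually) blast
  qed simp
  moreover have "?s \<longlonglongrightarrow> (\<Sum>j. ennreal (keep_ratio ^ j / n) * stopped_survivors j)"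
    by (rule summable_LIMSEQ) simp
  ultimately have "(\<lambda>m. ?s m + ennreal (keep_ratio ^ m) * alive_value m)
      \<longlonglongrightarrow> (\<Sum>j. ennreal (keep_ratio ^ j / n) * stopped_survivors j) + 0"
    by (intro tendsto_add)
  then show ?thesis
    unfolding sum_stopped_survivors by (simp add: LIMSEQ_const_iff)
qed

abbreviation estimate :: "'b \<Rightarrow> real" where
  "estimate \<omega> \<equiv> ams_estimator \<mu> n k a x (\<lambda>i. X0 i \<omega>) (\<lambda>j l. U j l \<omega>)"

lemma estimate_nonneg: "0 \<le> estimate \<omega>"
  using keep_ratio_bounds by (simp add: ams_estimator_def ams_final_fraction_def keep_ratio_def)

text \<open>
  At most one summand is nonzero, namely that of the stopping iteration; on runs that never stop
  all of them vanish, in accordance with the value \<open>0\<close> of the estimator.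
\<close>

lemma ennreal_estimate:
  "ennreal (estimate \<omega>)
    = (\<Sum>j. ennreal (keep_ratio ^ j / n) * (if running_at j \<omega> \<and> \<not> running_at (Suc j) \<omega> then survivors n a (cloud_at j \<omega>) else 0))"
proof -
  let ?X0 = "\<lambda>i. X0 i \<omega>" and ?U = "\<lambda>j l. U j l \<omega>"
  let ?P = "\<lambda>j. a \<le> ams_level \<mu> n k x ?X0 ?U (Suc j)"
  have stop: "running_at j \<omega> \<and> \<not> running_at (Suc j) \<omega> \<longleftrightarrow> (\<forall>i<j. \<not> ?P i) \<and> ?P j" for j
    unfolding running_at_Suc unfolding running_def ams_level_Suc[OF k_in] not_less[symmetric] by blast
  show ?thesis
  proof (cases "ams_terminates \<mu> n k a x ?X0 ?U")
    case False
    then have "\<not> ?P j" for j by (simp add: ams_terminates_def)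
    then have never: "(running_at j \<omega> \<and> \<not> running_at (Suc j) \<omega>) = False" for j unfolding stop by blast
    show ?thesis unfolding never using False by (simp add: ams_estimator_def)
  next
    case True
    define J where "J = ams_iterations \<mu> n k a x ?X0 ?U"
    have J: "?P J"
      unfolding J_def ams_iterations_def using True unfolding ams_terminates_def by (rule LeastI_ex)
    have before_J: "\<not> ?P i" if "i < J" for i
      using that unfolding J_def ams_iterations_def by (rule not_less_Least)
    have stop_J: "running_at j \<omega> \<and> \<not> running_at (Suc j) \<omega> \<longleftrightarrow> j = J" for j
      unfolding stop using J before_J by (metis linorder_neqE_nat)
    have "(\<Sum>j. ennreal (keep_ratio ^ j / n) * (if running_at j \<omega> \<and> \<not> running_at (Suc j) \<omega> then survivors n a (cloud_at j \<omega>) else 0))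
      = (\<Sum>j. if j = J then ennreal (keep_ratio ^ j / n) * survivors n a (cloud_at j \<omega>) else 0)"
      unfolding stop_J by (intro suminf_cong) simp
    also have "\<dots> = ennreal (keep_ratio ^ J / n) * survivors n a (cloud_at J \<omega>)"
      using sums_unique[OF sums_single[of J "\<lambda>j. ennreal (keep_ratio ^ j / n) * survivors n a (cloud_at j \<omega>)"]] by simp
    also have "\<dots> = ennreal (keep_ratio ^ J / n * real (card {i \<in> {1..n}. a \<le> cloud_at J \<omega> i}))"
      using keep_ratio_bounds by (simp only: survivors_eq_card ennreal_of_nat_eq_real_of_nat ennreal_mult''[symmetric] of_nat_0_le_iff)
    also have "{i \<in> {1..n}. a \<le> cloud_at J \<omega> i} = {i \<in> {1..n}. a \<le> ams_particles \<mu> n k ?X0 ?U J i}"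
      by (auto simp: cloud_def)
    also have "keep_ratio ^ J / n * real (card {i \<in> {1..n}. a \<le> ams_particles \<mu> n k ?X0 ?U J i}) = estimate \<omega>"
      using True by (simp add: ams_estimator_def ams_final_fraction_def J_def[symmetric] keep_ratio_def)
    finally show ?thesis ..
  qed
qed

text \<open>
  Measurability of the estimator is read off from its series, and the expectation is then taken
  termwise.
\<close>

lemma expectation_estimate: "expectation estimate = measure (cond_law \<mu> x) {a..}"
proof -
  have stopped: "(\<lambda>\<omega>. if running_at j \<omega> \<and> \<not> running_at (Suc j) \<omega> then survivors n a (cloud_at j \<omega>) else 0) \<in> borel_measurable N" for j
    by (rule measurable_If[OF measurable_survivors_at measurable_const sets_stopped]) simp
  have summand: "(\<lambda>\<omega>. ennreal (keep_ratio ^ j / n) * (if running_at j \<omega> \<and> \<not> running_at (Suc j) \<omega> then survivors n a (cloud_at j \<omega>) else 0))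
    \<in> borel_measurable N" for j
    by (intro borel_measurable_times_ennreal stopped measurable_const) simp
  have "(\<lambda>\<omega>. ennreal (estimate \<omega>)) \<in> borel_measurable N"
    unfolding ennreal_estimate by (rule borel_measurable_suminf_order[OF summand])
  then have "(\<lambda>\<omega>. enn2real (ennreal (estimate \<omega>))) \<in> borel_measurable N"
    by (rule measurable_compose) simp
  then have estimate: "estimate \<in> borel_measurable N" by (simp add: estimate_nonneg)
  have "expectation estimate = enn2real (\<integral>\<^sup>+\<omega>. ennreal (estimate \<omega>) \<partial>N)"
    by (rule integral_eq_nn_integral[OF estimate]) (simp add: estimate_nonneg)
  also have "(\<integral>\<^sup>+\<omega>. ennreal (estimate \<omega>) \<partial>N) = (\<Sum>j. ennreal (keep_ratio ^ j / n) * stopped_survivors j)"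
    unfolding ennreal_estimate stopped_survivors_def
    by (subst nn_integral_suminf[OF summand]) (simp only: nn_integral_cmult[OF stopped])
  also have "\<dots> = emeasure (cond_law \<mu> x) {a..}"
    unfolding suminf_stopped_survivors by (rule hit_prob_eq[OF \<mu> emeasure_above[OF x_le]])
  finally show ?thesis by (simp add: measure_def)
qed

end

theorem theorem4p1:
  fixes M :: "'a measure" and X :: "'a \<Rightarrow> real"
    and N :: "'b measure" and X0 :: "nat \<Rightarrow> 'b \<Rightarrow> real" and U :: "nat \<Rightarrow> nat \<Rightarrow> 'b \<Rightarrow> real"
    and n k :: nat and a x :: real
  assumes "prob_space M"
    and "X \<in> borel_measurable M"
    and "AE \<omega> in M. 0 < X \<omega>"
    and "continuous_on UNIV (cdf (distr M borel X))"
    and "1 \<le> k" and "k \<le> n - 1"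
    and "0 < a" and "\<P>(\<omega> in M. a < X \<omega>) > 0"
    and "0 \<le> x" and "x \<le> a"
    and "prob_space N"
    and "prob_space.indep_vars N (\<lambda>_. borel) (case_sum X0 (\<lambda>(j, l). U j l))
           ({1..n} <+> ({1..} \<times> {1..k}))"
    and "\<And>i. i \<in> {1..n} \<Longrightarrow> distr N borel (X0 i) = cond_law (distr M borel X) x"
    and "\<And>j l. 1 \<le> j \<Longrightarrow> l \<in> {1..k} \<Longrightarrow>
           distr N borel (U j l) = uniform_measure lborel {0<..<1}"
  shows "prob_space.expectation N
           (\<lambda>\<omega>. ams_estimator (distr M borel X) n k a x (\<lambda>i. X0 i \<omega>) (\<lambda>j l. U j l \<omega>))
         = \<P>(\<omega> in M. a < X \<omega> \<bar> x < X \<omega>) \<and>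
         (x = 0 \<longrightarrow> prob_space.expectation N
           (\<lambda>\<omega>. ams_estimator (distr M borel X) n k a 0 (\<lambda>i. X0 i \<omega>) (\<lambda>j l. U j l \<omega>))
         = \<P>(\<omega> in M. a < X \<omega>))"
proof -
  define \<mu> where "\<mu> = distr M borel X"
  interpret M: prob_space M by fact
  have X[measurable]: "X \<in> borel_measurable M" by fact
  have real\<mu>: "real_distribution \<mu>" unfolding \<mu>_def by (rule M.real_distribution_distr[OF X])
  interpret \<mu>: real_distribution \<mu> by (rule real\<mu>)
  have no_atom: "measure \<mu> {t} = 0" for t
    using assms(4) \<mu>.isCont_cdf[of t] by (simp add: \<mu>_def continuous_on_eq_continuous_at)
  have above: "measure \<mu> {t<..} = \<P>(\<omega> in M. t < X \<omega>)" for t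
    unfolding \<mu>_def by (subst measure_distr) (auto intro!: arg_cong[where f=M.prob])
  interpret ams_run N \<mu> n k a x X0 U
  proof (intro ams_run.intro ams_run_axioms.intro)
    show "emeasure \<mu> {a<..} \<noteq> 0" using assms(8) above[of a] by (simp add: \<mu>.emeasure_eq_measure)
    show "k < n" using assms(5,6) by simp
  qed (use assms real\<mu> in \<open>simp_all add: \<mu>_def[symmetric] \<mu>.emeasure_eq_measure no_atom\<close>)
  have x: "emeasure \<mu> {x<..} \<noteq> 0" by (rule emeasure_above[OF x_le])
  have "measure \<mu> ({x<..} \<inter> {a..}) = measure \<mu> {a<..}"
  proof (rule measure_eq_AE)
    have "AE t in \<mu>. t \<noteq> a"
      by (rule AE_I[of _ _ "{a}"]) (auto simp: \<mu>.emeasure_eq_measure no_atom)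
    then show "AE t in \<mu>. t \<in> {x<..} \<inter> {a..} \<longleftrightarrow> t \<in> {a<..}"
      by eventually_elim (use x_le in auto)
  qed auto
  then have "measure (cond_law \<mu> x) {a..} = measure \<mu> {a<..} / measure \<mu> {x<..}"
    unfolding cond_law_def using x by (subst measure_uniform_measure) auto
  also have "\<dots> = \<P>(\<omega> in M. a < X \<omega> \<bar> x < X \<omega>)"
  proof -
    have "\<P>(\<omega> in M. a < X \<omega> \<and> x < X \<omega>) = \<P>(\<omega> in M. a < X \<omega>)"
      using x_le by (intro arg_cong[where f=M.prob]) auto
    then show ?thesis by (simp only: above cond_prob_def)
  qed
  finally have main: "expectation estimate = \<P>(\<omega> in M. a < X \<omega> \<bar> x < X \<omega>)"
    unfolding expectation_estimate .
  have "\<P>(\<omega> in M. a < X \<omega> \<bar> x < X \<omega>) = \<P>(\<omega> in M. a < X \<omega>)" if "x = 0"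
  proof -
    have "\<P>(\<omega> in M. a < X \<omega> \<bar> 0 < X \<omega>) = \<P>(\<omega> in M. a < X \<omega> \<bar> True)"
      using assms(3) by (intro M.cond_prob_eq_AE) auto
    also have "\<dots> = \<P>(\<omega> in M. a < X \<omega>)" by (simp add: cond_prob_def M.prob_space)
    finally show ?thesis using that by simp
  qed
  with main show ?thesis unfolding \<mu>_def by auto
qed

end
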